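(* For every $n\in\mathbb N$, $n\ge 1$: $\mathrm{XC}_n\le_{\mathrm W}\mathrm{Sort}_{n+1}$.
   Context: A represented space $\mathbf X$ is a set $X$ with a partial surjection $\delta_{\mathbf X}:\subseteq\mathbb N^{\mathbb N}\to X$ (a $p$ with $\delta_{\mathbf X}(p)=x$ is a name of $x$). A realizer of a (partial) multivalued function $f:\subseteq\mathbf X\rightrightarrows\mathbf Y$ is a partial $F:\subseteq\mathbb N^{\mathbb N}\to\mathbb N^{\mathbb N}$ with $\delta_{\mathbf Y}(F(p))\in f(\delta_{\mathbf X}(p))$ for all names $p$ of points of $\mathrm{dom}(f)$; write $F\vdash f$. Weihrauch reducibility: $f\le_{\mathrm W}g$ iff there are computable $H,K:\subseteq\mathbb N^{\mathbb N}\to\mathbb N^{\mathbb N}$ such that $(p\mapsto K\langle p,GH(p)\rangle)\vdash f$ for every $G\vdash g$. $\mathcal A(\mathbf X)$ is the represented space of closed subsets of $\mathbf X$ with negative information: a name of $A$ is a name of the open set $X\setminus A$ (its continuous characteristic function into Sierpiński space). Closed choice $\mathrm C_{\mathbf X}:\subseteq\mathcal A(\mathbf X)\rightrightarrows\mathbf X$ maps a non-empty closed set $A$ to an arbitrary point of $A$. $\mathrm{XC}_n$ is the restriction of $\mathrm C_{[0,1]^n}$ to (non-empty closed) convex sets. $\mathrm{Sort}_d:\{0,\dots,d-1\}^\omega\to\{0,\dots,d-1\}^\omega$ is defined by $\mathrm{Sort}_d(p)=0^{c_0}1^{c_1}\cdots(m-1)^{c_{m-1}}m^{\infty}$, where $m$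 is the least symbol occurring infinitely often in $p$ and $c_l=|\{n: p(n)=l\}|$ for $l<m$. *)

theory Defs
  imports "HOL-Analysis.Analysis" "HOL-Library.Nat_Bijection" "HOL-Library.Countable"
begin

section \<open>Computability on Baire space\<close>

type_synonym baire = "nat \<Rightarrow> nat"

text \<open>
  Kleene's partial recursive functions relative to an oracle \<open>p\<close>. Wrong arities yield \<open>None\<close>;
  \<open>PrimRec f g\<close> recurses on the first argument, \<open>g\<close> receiving the counter, the previous
  value and the parameters; \<open>Mu f\<close> searches for a zero in the first argument of \<open>f\<close>.
\<close>

datatype prog =
    Zero
  | Succ
  | Proj nat
  | Oracle
  | Comp prog "prog list"
  | PrimRec prog prog
  | Mu prog

fun peval :: "prog \<Rightarrow> baire \<Rightarrow> nat list \<Rightarrow> nat option" where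
  "peval Zero p xs = Some 0"
| "peval Succ p xs = (case xs of [x] \<Rightarrow> Some (Suc x) | _ \<Rightarrow> None)"
| "peval (Proj i) p xs = (if i < length xs then Some (xs ! i) else None)"
| "peval Oracle p xs = (case xs of [x] \<Rightarrow> Some (p x) | _ \<Rightarrow> None)"
| "peval (Comp f gs) p xs =
     (let vs = map (\<lambda>g. peval g p xs) gs
      in if None \<in> set vs then None else peval f p (map the vs))"
| "peval (PrimRec f g) p xs =
     (case xs of
        [] \<Rightarrow> None
      | x # ys \<Rightarrow>
          rec_nat (peval f p ys)
            (\<lambda>k r. case r of None \<Rightarrow> None | Some v \<Rightarrow> peval g p (k # v # ys)) x)"
| "peval (Mu f) p xs =
     (if \<exists>k. peval f p (k # xs) = Some 0 \<and> (\<forall>j<k. peval f p (j # xs) \<noteq> None)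
      then Some (LEAST k. peval f p (k # xs) = Some 0)
      else None)"

text \<open>
  As usual for realizers, only the behaviour on the domain of \<open>F\<close> is prescribed: the program
  may also produce output elsewhere.
\<close>

definition computable :: "(baire \<rightharpoonup> baire) \<Rightarrow> bool" where
  "computable F \<longleftrightarrow>
     (\<exists>e. \<forall>p q. F p = Some q \<longrightarrow> (\<forall>n. peval e p [n] = Some (q n)))"

definition baire_pair :: "baire \<Rightarrow> baire \<Rightarrow> baire" where
  "baire_pair p q = (\<lambda>n. if even n then p (n div 2) else q (n div 2))"


section \<open>Represented spaces and Weihrauch reducibility\<close>

text \<open>
  A represented space is given by its representation; its set of points is the range
  \<open>ran \<delta>\<close>, so that surjectivity holds by construction.
\<close>

type_synonym 'a rep = "baire \<rightharpoonup> 'a"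

definition rep_of :: "(baire \<Rightarrow> 'a \<Rightarrow> bool) \<Rightarrow> 'a rep" where
  "rep_of R p = (if \<exists>!x. R p x then Some (THE x. R p x) else None)"

lemma rep_of_eq_Some_iff:
  assumes "\<And>x y. R p x \<Longrightarrow> R p y \<Longrightarrow> x = y"
  shows "rep_of R p = Some x \<longleftrightarrow> R p x"
proof -
  have "(\<exists>!x. R p x) \<longleftrightarrow> (\<exists>x. R p x)"
    using assms by blast
  moreover have "(THE y. R p y) = x" if "R p x"
    using that assms by blast
  moreover have "R p (THE y. R p y)" if "\<exists>!x. R p x"
    using that by (rule theI')
  ultimately show ?thesis
    unfolding rep_of_def by (metis option.distinct(1) option.inject)
qed

text \<open>
  A partial multivalued function \<open>f :\<subseteq> X \<rightrightarrows> Y\<close>. A point \<open>x\<close> of \<open>X\<close> belongs to the domain iff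
  \<open>val f x \<noteq> {}\<close>; the values at arguments that are not points of \<open>X\<close> are irrelevant.
\<close>

record ('a, 'b) problem =
  src :: "'a rep"
  tgt :: "'b rep"
  val :: "'a \<Rightarrow> 'b set"

definition realizes :: "(baire \<rightharpoonup> baire) \<Rightarrow> ('a, 'b) problem \<Rightarrow> bool"  (infix "\<turnstile>\<^sub>R" 50) where
  "F \<turnstile>\<^sub>R f \<longleftrightarrow>
     (\<forall>p x. src f p = Some x \<and> val f x \<noteq> {} \<longrightarrow>
        (\<exists>q y. F p = Some q \<and> tgt f q = Some y \<and> y \<in> val f x))"

definition weihrauch_le :: "('a, 'b) problem \<Rightarrow> ('c, 'd) problem \<Rightarrow> bool"
    (infix "\<le>\<^sub>W" 50) where
  "f \<le>\<^sub>W g \<longleftrightarrow>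
     (\<exists>H K. computable H \<and> computable K \<and>
        (\<forall>G. G \<turnstile>\<^sub>R g \<longrightarrow>
           (\<lambda>p. Option.bind (H p) (\<lambda>h.
                Option.bind (G h) (\<lambda>r. K (baire_pair p r)))) \<turnstile>\<^sub>R f))"

definition restrict_problem :: "('a, 'b) problem \<Rightarrow> 'a set \<Rightarrow> ('a, 'b) problem" where
  "restrict_problem f D = f\<lparr>val := (\<lambda>x. if x \<in> D then val f x else {})\<rparr>"


section \<open>Function spaces and closed sets\<close>

text \<open>
  Application of a Kleene associate: \<open>\<alpha>\<close> is queried on the code of \<open>m\<close> followed by longer and
  longer prefixes of \<open>p\<close>; \<open>0\<close> asks for a longer prefix, and the first answer \<open>Suc v\<close> means that
  the \<open>m\<close>-th output is \<open>v\<close>.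
\<close>

definition query :: "baire \<Rightarrow> baire \<Rightarrow> nat \<Rightarrow> nat \<Rightarrow> nat" where
  "query \<alpha> p m k = \<alpha> (list_encode (m # map p [0..<k]))"

definition assoc_app :: "baire \<Rightarrow> (baire \<rightharpoonup> baire)" where
  "assoc_app \<alpha> p =
     (if \<forall>m. \<exists>k. query \<alpha> p m k \<noteq> 0
      then Some (\<lambda>m. query \<alpha> p m (LEAST k. query \<alpha> p m k \<noteq> 0) - 1)
      else None)"

text \<open>
  The space of continuous functions from \<open>X\<close> to \<open>Y\<close>: a name of \<open>f\<close> is an associate of a
  realizer of \<open>f\<close>. Functions are \<open>undefined\<close> outside the points of \<open>X\<close>.
\<close>

definition fun_name :: "'a rep \<Rightarrow> 'b rep \<Rightarrow> baire \<Rightarrow> ('a \<Rightarrow> 'b) \<Rightarrow> bool" where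
  "fun_name X Y \<alpha> f \<longleftrightarrow>
     f \<in> extensional (ran X) \<and>
     assoc_app \<alpha> \<turnstile>\<^sub>R \<lparr>src = X, tgt = Y, val = (\<lambda>x. {f x})\<rparr>"

definition fun_rep :: "'a rep \<Rightarrow> 'b rep \<Rightarrow> ('a \<Rightarrow> 'b) rep" where
  "fun_rep X Y = rep_of (fun_name X Y)"

lemma fun_rep_eq_Some_iff: "fun_rep X Y \<alpha> = Some f \<longleftrightarrow> fun_name X Y \<alpha> f"
  unfolding fun_rep_def
proof (rule rep_of_eq_Some_iff)
  fix f g
  assume f: "fun_name X Y \<alpha> f" and g: "fun_name X Y \<alpha> g"
  show "f = g"
  proof (rule extensionalityI)
    show "f \<in> extensional (ran X)" "g \<in> extensional (ran X)"
      using f g by (auto simp: fun_name_def)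
    fix x
    assume "x \<in> ran X"
    then obtain p where "X p = Some x"
      by (auto simp: ran_def)
    with f g show "f x = g x"
      by (fastforce simp: fun_name_def realizes_def)
  qed
qed

text \<open>Sierpinski space; \<open>True\<close> is the open point.\<close>

definition sierpinski_rep :: "bool rep" where
  "sierpinski_rep p = Some (\<exists>n. p n \<noteq> 0)"

definition open_rep :: "'a rep \<Rightarrow> 'a set rep" where
  "open_rep X \<alpha> = map_option (\<lambda>f. {x \<in> ran X. f x}) (fun_rep X sierpinski_rep \<alpha>)"

definition closed_rep :: "'a rep \<Rightarrow> 'a set rep" where
  "closed_rep X \<alpha> = map_option (\<lambda>U. ran X - U) (open_rep X \<alpha>)"

definition closed_choice :: "'a rep \<Rightarrow> ('a set, 'a) problem" where
  "closed_choice X = \<lparr>src = closed_rep X, tgt = X, val = (\<lambda>A. A)\<rparr>"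


section \<open>The unit cube and convex choice\<close>

definition real_name :: "baire \<Rightarrow> real \<Rightarrow> bool" where
  "real_name p x \<longleftrightarrow> (\<forall>k. \<bar>of_rat (nat_to_rat_surj (p k)) - x\<bar> \<le> (1/2) ^ k)"

definition real_rep :: "real rep" where
  "real_rep = rep_of real_name"

lemma real_rep_eq_Some_iff: "real_rep p = Some x \<longleftrightarrow> real_name p x"
  unfolding real_rep_def
proof (rule rep_of_eq_Some_iff)
  fix x y
  assume x: "real_name p x" and y: "real_name p y"
  let ?q = "\<lambda>k. of_rat (nat_to_rat_surj (p k)) :: real"
  have lim: "(\<lambda>k. (1/2::real) ^ k) \<longlonglongrightarrow> 0"
    by (rule LIMSEQ_power_zero) simp
  have "?q \<longlonglongrightarrow> z" if "real_name p z" for z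
    using that
    by (intro metric_tendsto_imp_tendsto[OF lim]) (auto simp: real_name_def dist_real_def)
  with x y show "x = y"
    by (blast intro: LIMSEQ_unique)
qed

definition subspace_rep :: "'a rep \<Rightarrow> 'a set \<Rightarrow> 'a rep" where
  "subspace_rep X S p = Option.bind (X p) (\<lambda>x. if x \<in> S then Some x else None)"

text \<open>
  Finite powers \<open>X\<^sup>n\<close>: names of the coordinates are interleaved with period \<open>n\<close>, the coordinates
  being numbered by the bijection \<open>to_nat_on UNIV\<close> from the index type onto \<open>{..<n}\<close>.
\<close>

definition component :: "baire \<Rightarrow> 'n::finite \<Rightarrow> baire" where
  "component p i = (\<lambda>k. p (CARD('n) * k + to_nat_on (UNIV :: 'n set) i))"

definition power_rep :: "'a rep \<Rightarrow> ('a ^ 'n) rep" where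
  "power_rep X p =
     (if \<forall>i::'n::finite. X (component p i) \<noteq> None
      then Some (\<chi> i. the (X (component p i)))
      else None)"

definition unit_cube_rep :: "(real ^ 'n) rep" where
  "unit_cube_rep = power_rep (subspace_rep real_rep {0..1})"

definition XC :: "((real ^ 'n) set, real ^ 'n) problem" where
  "XC = restrict_problem (closed_choice unit_cube_rep) {A. convex A}"


section \<open>Sorting\<close>

text \<open>The space \<open>{0,\<dots>,d-1}\<^sup>\<omega>\<close>, every sequence being its own name.\<close>

definition seq_rep :: "nat \<Rightarrow> baire rep" where
  "seq_rep d p = (if \<forall>n. p n < d then Some p else None)"

definition sort_limit :: "baire \<Rightarrow> nat" where
  "sort_limit p = (LEAST m. infinite {n. p n = m})"

definition sort_prefix :: "baire \<Rightarrow> nat list" where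
  "sort_prefix p = concat (map (\<lambda>l. replicate (card {n. p n = l}) l) [0..<sort_limit p])"

definition sort_seq :: "baire \<Rightarrow> baire" where
  "sort_seq p =
     (\<lambda>k. if k < length (sort_prefix p) then sort_prefix p ! k else sort_limit p)"

definition Sort :: "nat \<Rightarrow> (baire, baire) problem" where
  "Sort d = \<lparr>src = seq_rep d, tgt = seq_rep d, val = (\<lambda>p. {sort_seq p})\<rparr>"

end

theory Submission
  imports Defs
begin

text \<open>
  Nested boxes \<open>B\<^sub>0 \<supseteq> B\<^sub>1 \<supseteq> \<dots> \<supseteq> B\<^sub>n\<close> are maintained, where \<open>B\<^sub>0\<close> starts as the unit cube and
  \<open>B\<^sub>j\<^sub>+\<^sub>1\<close> starts as the section of \<open>B\<^sub>j\<close> by the hyperplane bisecting its longest edge. By compactness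
  it is semidecidable that a closed half of \<open>B\<^sub>j\<close> misses \<open>A\<close>. In each round, the least \<open>j\<close> for which this
  has been found out is emitted, \<open>B\<^sub>j\<close> is replaced by its other half, and the deeper boxes are created
  afresh; if there is none, \<open>n\<close> is emitted. Let \<open>m\<close> be the least symbol emitted infinitely often. By
  convexity, a box meeting \<open>A\<close> both of whose halves meet \<open>A\<close> has a middle section meeting \<open>A\<close>; hence
  finally \<open>B\<^sub>m\<close> meets \<open>A\<close>, and it shrinks to a point \<open>x\<close> (\<open>B\<^sub>n\<close> is a point from the start).

  The sorted sequence shows some \<open>j\<close> only after all emissions of symbols below \<open>j\<close>. So once a
  simulation has reproduced these emissions, \<open>B\<^sub>j\<close> can only shrink, and it contains the final \<open>B\<^sub>m\<close>, hence \<open>x\<close>: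
  its corners approximate \<open>x\<close> even if \<open>j < m\<close>. With \<open>j = m\<close> every precision is reached.
\<close>

section \<open>Total functionals computed by programs\<close>

text \<open>The length of a code depends on the type alone, so one program of fixed arity serves all
  environments of a type.\<close>

class env =
  fixes enc :: "'a \<Rightarrow> nat list"
  assumes length_enc: "length (enc x) = length (enc y)"

instantiation nat :: env
begin
definition enc_nat :: "nat \<Rightarrow> nat list" where "enc_nat x = [x]"
instance by standard (simp add: enc_nat_def)
end

instantiation prod :: (env, env) env
begin
definition enc_prod :: "'a \<times> 'b \<Rightarrow> nat list" where "enc_prod x = enc (fst x) @ enc (snd x)"
instance by standard (metis enc_prod_def length_append length_enc)
end

lemma enc_simps [simp]: "enc (x :: nat) = [x]" "enc (a, b) = enc a @ enc b"
  by (simp_all add: enc_nat_def enc_prod_def)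

text \<open>
  The environment \<open>c\<close> is a nested pair of numbers, so that the rules below are higher-order
  patterns and a definition is shown to be computable by applying introduction rules to its body.
\<close>

definition rcomp :: "(baire \<Rightarrow> 'c::env \<Rightarrow> nat) \<Rightarrow> bool" where
  "rcomp f \<longleftrightarrow> (\<exists>e. \<forall>p c. peval e p (enc c) = Some (f p c))"

definition rdec :: "(baire \<Rightarrow> 'c::env \<Rightarrow> bool) \<Rightarrow> bool" where
  "rdec P \<longleftrightarrow> rcomp (\<lambda>p c. of_bool (P p c))"

named_theorems rc

lemma rcomp_id [rc]: "rcomp (\<lambda>p (c::nat). c)"
  unfolding rcomp_def by (rule exI[of _ "Proj 0"]) simp

lemma rcomp_fst [rc]: "rcomp (\<lambda>p (c::nat \<times> 'c::env). fst c)"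
  unfolding rcomp_def by (rule exI[of _ "Proj 0"]) (simp add: enc_prod_def)

lemma peval_shift:
  fixes c :: "nat \<times> 'c::env"
  shows "map (\<lambda>g. peval g p (enc c)) (map (\<lambda>i. Proj (Suc i)) [0..<length (enc (undefined :: 'c))])
     = map Some (enc (snd c))"
  by (rule nth_equalityI) (auto simp: enc_prod_def length_enc[of "snd c" undefined])

lemma peval_Comp_Some:
  assumes "map (\<lambda>g. peval g p xs) gs = map Some vs"
  shows "peval (Comp f gs) p xs = peval f p vs"
proof -
  have "peval (Comp f gs) p xs =
    (if None \<in> set (map Some vs) then None else peval f p (map the (map Some vs)))"
    by (simp only: peval.simps Let_def assms)
  then show ?thesis by (simp add: comp_def)
qed

text \<open>Weakening: a program is composed with the projections that drop the first argument.
  Iteration gives the rules for access to the variables of nested environments.\<close>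

lemma rcomp_snd:
  fixes f :: "baire \<Rightarrow> 'c::env \<Rightarrow> nat"
  assumes "rcomp f"
  shows "rcomp (\<lambda>p (c::nat \<times> 'c). f p (snd c))"
proof -
  obtain e where e: "\<And>p c. peval e p (enc c) = Some (f p c)"
    using assms by (auto simp: rcomp_def)
  show ?thesis
    unfolding rcomp_def
    by (intro exI[of _ "Comp e (map (\<lambda>i. Proj (Suc i)) [0..<length (enc (undefined :: 'c))])"] allI)
      (subst peval_Comp_Some[OF peval_shift], simp add: e)
qed

lemmas rcomp_fst2 [rc] = rcomp_snd[OF rcomp_fst]
lemmas rcomp_fst3 [rc] = rcomp_snd[OF rcomp_fst2]
lemmas rcomp_fst4 [rc] = rcomp_snd[OF rcomp_fst3]
lemmas rcomp_fst5 [rc] = rcomp_snd[OF rcomp_fst4]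
lemmas rcomp_fst6 [rc] = rcomp_snd[OF rcomp_fst5]
lemmas rcomp_snd1 [rc] = rcomp_snd[OF rcomp_id]
lemmas rcomp_snd2 [rc] = rcomp_snd[OF rcomp_snd1]
lemmas rcomp_snd3 [rc] = rcomp_snd[OF rcomp_snd2]
lemmas rcomp_snd4 [rc] = rcomp_snd[OF rcomp_snd3]
lemmas rcomp_snd5 [rc] = rcomp_snd[OF rcomp_snd4]
lemmas rcomp_snd6 [rc] = rcomp_snd[OF rcomp_snd5]

section \<open>Closure under composition, primitive recursion and arithmetic\<close>

lemma rcomp_app1:
  assumes "rcomp (\<lambda>p (x::nat). f p x)" "rcomp (a :: _ \<Rightarrow> 'c::env \<Rightarrow> _)"
  shows "rcomp (\<lambda>p c. f p (a p c))"
proof -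
  obtain e ea where "\<And>p c. peval e p (enc c) = Some (f p c)"
    "\<And>p c. peval ea p (enc c) = Some (a p c)"
    using assms by (auto simp: rcomp_def)
  then show ?thesis
    unfolding rcomp_def by (intro exI[of _ "Comp e [ea]"]) simp
qed

lemma rcomp_app2:
  assumes "rcomp (\<lambda>p (c::nat\<times>nat). f p (fst c) (snd c))"
    "rcomp (a :: _ \<Rightarrow> 'c::env \<Rightarrow> _)" "rcomp b"
  shows "rcomp (\<lambda>p c. f p (a p c) (b p c))"
proof -
  obtain e ea eb where e: "\<And>p c. peval e p (enc c) = Some (f p (fst c) (snd c))"
    "\<And>p c. peval ea p (enc c) = Some (a p c)" "\<And>p c. peval eb p (enc c) = Some (b p c)"
    using assms unfolding rcomp_def by metis
  show ?thesis
    unfolding rcomp_def using e(1)[of _ "(_, _)"] by (intro exI[of _ "Comp e [ea, eb]"]) (simp add: e)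
qed

lemma rcomp_app3:
  assumes "rcomp (\<lambda>p (c::nat\<times>nat\<times>nat). f p (fst c) (fst (snd c)) (snd (snd c)))"
    "rcomp (a :: _ \<Rightarrow> 'c::env \<Rightarrow> _)" "rcomp b" "rcomp d"
  shows "rcomp (\<lambda>p c. f p (a p c) (b p c) (d p c))"
proof -
  obtain e ea eb ed where e: "\<And>p c. peval e p (enc c) = Some (f p (fst c) (fst (snd c)) (snd (snd c)))"
    "\<And>p c. peval ea p (enc c) = Some (a p c)" "\<And>p c. peval eb p (enc c) = Some (b p c)"
    "\<And>p c. peval ed p (enc c) = Some (d p c)"
    using assms unfolding rcomp_def by metis
  show ?thesis
    unfolding rcomp_def using e(1)[of _ "(_, _, _)"]
    by (intro exI[of _ "Comp e [ea, eb, ed]"]) (simp add: e)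
qed

lemma rdec_app2:
  assumes "rdec (\<lambda>p (c::nat\<times>nat). f p (fst c) (snd c))"
    "rcomp (a :: _ \<Rightarrow> 'c::env \<Rightarrow> _)" "rcomp b"
  shows "rdec (\<lambda>p c. f p (a p c) (b p c))"
  using assms unfolding rdec_def by (rule rcomp_app2)

lemma rcomp_Suc [rc]: "rcomp a \<Longrightarrow> rcomp (\<lambda>p c. Suc (a p c))"
  by (rule rcomp_app1[where f = "\<lambda>p. Suc"]) (auto simp: rcomp_def intro: exI[of _ Succ])

lemma rcomp_const [rc]: "rcomp (\<lambda>p (c::'c::env). k)"
proof (induction k)
  case 0
  then show ?case unfolding rcomp_def by (intro exI[of _ Zero]) simp
qed (rule rcomp_Suc)

lemma rcomp_oracle: "rcomp a \<Longrightarrow> rcomp (\<lambda>p c. p (a p c))"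
  by (rule rcomp_app1[where f = "\<lambda>p. p"]) (auto simp: rcomp_def intro: exI[of _ Oracle])

lemma rcomp_rec [rc]:
  fixes N :: "baire \<Rightarrow> 'c::env \<Rightarrow> nat"
  assumes "rcomp a" "rcomp (\<lambda>p (x::nat\<times>nat\<times>'c). h p (fst x) (fst (snd x)) (snd (snd x)))" "rcomp N"
  shows "rcomp (\<lambda>p c. rec_nat (a p c) (\<lambda>k r. h p k r c) (N p c))"
proof -
  obtain ea eh eN where e: "\<And>p c. peval ea p (enc c) = Some (a p c)"
    "\<And>p x. peval eh p (enc x) = Some (h p (fst x) (fst (snd x)) (snd (snd x)))"
    "\<And>p c. peval eN p (enc c) = Some (N p c)"
    using assms unfolding rcomp_def by metis
  let ?ps = "map Proj [0..<length (enc (undefined :: 'c))]"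
  have proj: "map (\<lambda>g. peval g p (enc c)) (eN # ?ps) = map Some (N p c # enc c)" for p and c :: 'c
    by (auto simp: e length_enc[of c undefined] intro!: nth_equalityI)
  \<comment> \<open>All values of \<open>a\<close> and \<open>h\<close> are defined, so the
    option-valued recursion never meets \<open>None\<close>.\<close>
  have "rec_nat (peval ea p (enc c)) (\<lambda>k r. case r of None \<Rightarrow> None | Some v \<Rightarrow> peval eh p (k # v # enc c)) x
    = Some (rec_nat (a p c) (\<lambda>k r. h p k r c) x)" for p c x
    by (induction x) (use e(2)[of _ "(_, _, _)"] in \<open>simp_all add: e\<close>)
  then have "peval (Comp (PrimRec ea eh) (eN # ?ps)) p (enc c)
    = Some (rec_nat (a p c) (\<lambda>k r. h p k r c) (N p c))" for p c
    by (subst peval_Comp_Some[OF proj]) simp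
  then show ?thesis
    unfolding rcomp_def by blast
qed

lemma rcomp_pred [rc]: "rcomp a \<Longrightarrow> rcomp (\<lambda>p c. a p c - 1)"
proof (rule rcomp_app1[where f = "\<lambda>p x. x - 1"])
  have eq: "x - 1 = rec_nat 0 (\<lambda>k r. k) x" for x :: nat
    by (cases x) auto
  have "(\<lambda>(p::baire) (x::nat). x - 1) = (\<lambda>p x. rec_nat 0 (\<lambda>k r. k) x)"
    by (intro ext) (rule eq)
  then show "rcomp (\<lambda>(p::baire) (x::nat). x - 1)"
    by (rule ssubst) (intro rc)
qed

lemma rcomp_add [rc]: "rcomp a \<Longrightarrow> rcomp b \<Longrightarrow> rcomp (\<lambda>p c. a p c + b p c)"
proof (rule rcomp_app2[where f = "\<lambda>p x y. x + y"])
  have "x + y = rec_nat x (\<lambda>k r. Suc r) y" for x y :: nat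
    by (induction y) auto
  then show "rcomp (\<lambda>p (c::nat\<times>nat). fst c + snd c)"
    by (simp only:) (intro rc)
qed

lemma rcomp_diff [rc]: "rcomp a \<Longrightarrow> rcomp b \<Longrightarrow> rcomp (\<lambda>p c. a p c - b p c)"
proof (rule rcomp_app2[where f = "\<lambda>p x y. x - y"])
  have eq: "x - y = rec_nat x (\<lambda>k r. r - 1) y" for x y :: nat
    by (induction y) auto
  have "(\<lambda>(p::baire) c. fst c - snd c) = (\<lambda>p c. rec_nat (fst c) (\<lambda>k r. r - 1) (snd c))"
    by (intro ext) (rule eq)
  then show "rcomp (\<lambda>p (c::nat\<times>nat). fst c - snd c)"
    by (rule ssubst) (intro rc)
qed

lemma rcomp_mult [rc]: "rcomp a \<Longrightarrow> rcomp b \<Longrightarrow> rcomp (\<lambda>p c. a p c * b p c)"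
proof (rule rcomp_app2[where f = "\<lambda>p x y. x * y"])
  have "x * y = rec_nat 0 (\<lambda>k r. r + x) y" for x y :: nat
    by (induction y) auto
  then show "rcomp (\<lambda>p (c::nat\<times>nat). fst c * snd c)"
    by (simp only:) (intro rc)
qed

lemma rcomp_power [rc]: "rcomp a \<Longrightarrow> rcomp b \<Longrightarrow> rcomp (\<lambda>p c. a p c ^ b p c)"
proof (rule rcomp_app2[where f = "\<lambda>p x y. x ^ y"])
  have "x ^ y = rec_nat 1 (\<lambda>k r. r * x) y" for x y :: nat
    by (induction y) auto
  then show "rcomp (\<lambda>p (c::nat\<times>nat). fst c ^ snd c)"
    by (simp only:) (intro rc)
qed

section \<open>Decidable conditions, bounded sums and bounded quantifiers\<close>

lemma rcomp_of_bool [rc]: "rdec P \<Longrightarrow> rcomp (\<lambda>p c. of_bool (P p c))"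
  by (simp add: rdec_def)

lemma rdecI: "rcomp (\<lambda>p c. of_bool (P p c)) \<Longrightarrow> rdec P"
  by (simp add: rdec_def)

lemma rdec_not [rc]:
  assumes "rdec P" shows "rdec (\<lambda>p c. \<not> P p c)"
proof (rule rdecI)
  have "of_bool (\<not> Q) = (1::nat) - of_bool Q" for Q
    by simp
  then show "rcomp (\<lambda>p c. of_bool (\<not> P p c))"
    by (simp only:) (intro rc assms)
qed

lemma rdec_conj [rc]:
  assumes "rdec P" "rdec Q" shows "rdec (\<lambda>p c. P p c \<and> Q p c)"
  by (rule rdecI, unfold of_bool_conj) (intro rc assms)

lemma rdec_disj [rc]:
  assumes "rdec P" "rdec Q" shows "rdec (\<lambda>p c. P p c \<or> Q p c)"
  using rdec_not[OF rdec_conj[OF rdec_not[OF assms(1)] rdec_not[OF assms(2)]]] by simp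

lemma rdec_imp [rc]:
  assumes "rdec P" "rdec Q" shows "rdec (\<lambda>p c. P p c \<longrightarrow> Q p c)"
  using rdec_disj[OF rdec_not[OF assms(1)] assms(2)] by simp

lemma rdec_eq0:
  assumes "rcomp a" shows "rdec (\<lambda>p c. a p c = 0)"
proof (rule rdecI)
  have "of_bool (x = 0) = (1::nat) - x" for x
    by simp
  then show "rcomp (\<lambda>p c. of_bool (a p c = 0))"
    by (simp only:) (intro rc assms)
qed

lemma rdec_le [rc]:
  assumes "rcomp a" "rcomp b" shows "rdec (\<lambda>p c. a p c \<le> b p c)"
  using rdec_eq0[OF rcomp_diff[OF assms]] by simp

lemma rdec_less [rc]: "rcomp a \<Longrightarrow> rcomp b \<Longrightarrow> rdec (\<lambda>p c. a p c < b p c)"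
  unfolding less_eq_Suc_le by (intro rc)

lemma rdec_eq [rc]: "rcomp a \<Longrightarrow> rcomp b \<Longrightarrow> rdec (\<lambda>p c. a p c = (b p c :: nat))"
  by (subst eq_iff) (intro rc)

lemma rcomp_if [rc]:
  assumes "rdec P" "rcomp a" "rcomp b"
  shows "rcomp (\<lambda>p c. if P p c then a p c else b p c)"
proof -
  have "(if Q then x else y) = of_bool Q * x + of_bool (\<not> Q) * y" for Q and x y :: nat
    by simp
  then show ?thesis
    by (simp only:) (intro rc assms)
qed

text \<open>Inside a recursion the environment carries two further numbers, such as counter and
  accumulator, in front of the parameters. This rule allows a function of one index and the
  parameters to be called there.\<close>

lemma rcomp_subst:
  assumes "rcomp (\<lambda>p (x::nat\<times>'c::env). f p (fst x) (snd x))" "rcomp (a :: _ \<Rightarrow> nat\<times>nat\<times>'c \<Rightarrow> nat)"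
  shows "rcomp (\<lambda>p (x::nat\<times>nat\<times>'c). f p (a p x) (snd (snd x)))"
proof -
  obtain e ea where e: "\<And>p x. peval e p (enc x) = Some (f p (fst x) (snd x))"
    "\<And>p x. peval ea p (enc x) = Some (a p x)"
    using assms unfolding rcomp_def by metis
  let ?w = "length (enc (undefined :: 'c))"
  let ?ps = "ea # map (\<lambda>i. Proj (Suc (Suc i))) [0..<?w]"
  have proj: "map (\<lambda>g. peval g p (enc x)) ?ps = map Some (enc (a p x, snd (snd x)))"
    for p and x :: "nat \<times> nat \<times> 'c"
  proof -
    obtain a k c where x: "x = (a, k, c)" by (cases x)
    show ?thesis
      by (rule nth_equalityI)
        (auto simp: x e(2)[of _ "(_, _, _)", simplified] length_enc[of c undefined] nth_Cons
          split: nat.split)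
  qed
  show ?thesis
    unfolding rcomp_def
    by (intro exI[of _ "Comp e ?ps"] allI) (subst peval_Comp_Some[OF proj], subst e, simp)
qed

lemma rcomp_sum [rc]:
  assumes "rcomp (\<lambda>p (x::nat\<times>'c). f p (fst x) (snd x))" "rcomp (N :: baire \<Rightarrow> 'c::env \<Rightarrow> nat)"
  shows "rcomp (\<lambda>p c. \<Sum>k<N p c. f p k c)"
proof -
  have eq: "(\<Sum>k<m. f p k c) = rec_nat 0 (\<lambda>k r. r + f p k c) m" for p c m
    by (induction m) auto
  show ?thesis
    unfolding eq by (intro rc assms rcomp_subst[OF assms(1)])
qed

lemma rdec_all [rc]:
  assumes "rdec (\<lambda>p (x::nat\<times>'c). P p (fst x) (snd x))" "rcomp (N :: baire \<Rightarrow> 'c::env \<Rightarrow> nat)"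
  shows "rdec (\<lambda>p c. \<forall>k<N p c. P p k c)"
proof -
  have "(\<forall>k<m. Q k) \<longleftrightarrow> (\<Sum>k<m. of_bool (\<not> Q k)) = (0::nat)" for Q and m :: nat
    by (subst sum_eq_0_iff) auto
  then show ?thesis
    by (simp only:) (intro rc assms)
qed

lemma rdec_ex [rc]:
  assumes "rdec (\<lambda>p (x::nat\<times>'c). P p (fst x) (snd x))" "rcomp (N :: baire \<Rightarrow> 'c::env \<Rightarrow> nat)"
  shows "rdec (\<lambda>p c. \<exists>k<N p c. P p k c)"
  using rdec_not[OF rdec_all[OF rdec_not[OF assms(1)] assms(2)]] by simp

section \<open>Pairs, division, lists and bounded search\<close>

lemma rcomp_prod_encode [rc]:
  "rcomp a \<Longrightarrow> rcomp b \<Longrightarrow> rcomp (\<lambda>p c. prod_encode (a p c, b p c))"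
proof (rule rcomp_app2[where f = "\<lambda>p x y. prod_encode (x, y)"])
  have "triangle m = (\<Sum>k<m. Suc k)" for m
    by (induction m) auto
  then have "prod_encode (x, y) = (\<Sum>k<x + y. Suc k) + x" for x y
    by (simp add: prod_encode_def)
  then show "rcomp (\<lambda>p (c::nat\<times>nat). prod_encode (fst c, snd c))"
    by (simp only:) (intro rc)
qed

text \<open>Decoding by exhaustive search: both components of a pair are at most its code, so
  exactly one term of the sum is selected.\<close>

lemma sum_sum_prod_encode:
  "(\<Sum>a<Suc z. \<Sum>b<Suc z. if prod_encode (a, b) = z then f a b else 0)
    = (f (fst (prod_decode z)) (snd (prod_decode z)) :: nat)"
proof -
  obtain u v where uv: "prod_decode z = (u, v)"
    by (cases "prod_decode z")
  then have z: "prod_encode (u, v) = z"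
    by (metis prod_decode_inverse)
  have "u < Suc z" "v < Suc z"
    using le_prod_encode_1[of u v] le_prod_encode_2[of v u] by (auto simp: z less_Suc_eq_le)
  moreover have "prod_encode (a, b) = z \<longleftrightarrow> a = u \<and> b = v" for a b
    unfolding z[symmetric] by simp
  ultimately have "(\<Sum>a<Suc z. \<Sum>b<Suc z. if prod_encode (a, b) = z then f a b else 0)
    = (\<Sum>a<Suc z. if a = u then \<Sum>b<Suc z. if b = v then f a b else 0 else 0)"
    by (intro sum.cong refl) auto
  then show ?thesis
    using \<open>u < Suc z\<close> \<open>v < Suc z\<close> by (simp add: uv sum.delta del: sum.lessThan_Suc)
qed

lemma rcomp_fst_decode [rc]: "rcomp a \<Longrightarrow> rcomp (\<lambda>p c. fst (prod_decode (a p c)))"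
  by (rule rcomp_app1[where f = "\<lambda>p x. fst (prod_decode x)"])
    (unfold sum_sum_prod_encode[where f = "\<lambda>a b. a", symmetric], intro rc)

lemma rcomp_snd_decode [rc]: "rcomp a \<Longrightarrow> rcomp (\<lambda>p c. snd (prod_decode (a p c)))"
  by (rule rcomp_app1[where f = "\<lambda>p x. snd (prod_decode x)"])
    (unfold sum_sum_prod_encode[where f = "\<lambda>a b. b", symmetric], intro rc)

text \<open>The quotient counts the positive multiples of the divisor that do not exceed the
  dividend.\<close>

lemma rcomp_div [rc]: "rcomp a \<Longrightarrow> rcomp b \<Longrightarrow> rcomp (\<lambda>p c. a p c div b p c)"
proof (rule rcomp_app2[where f = "\<lambda>p x y. x div y"])
  \<comment> \<open>Division by 0 yields 0, whereas the sum would then count every index.\<close>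
  have "x div y = (if y = 0 then 0 else \<Sum>k<x. of_bool (Suc k * y \<le> x))" for x y :: nat
  proof (cases "y = 0")
    case False
    then have "Suc k * y \<le> x \<longleftrightarrow> k < x div y" for k
      by (metis Suc_le_eq bot_nat_0.not_eq_extremum less_eq_div_iff_mult_less_eq)
    then have "{..<x} \<inter> {k. Suc k * y \<le> x} = {..<x div y}"
      by (auto simp del: mult_Suc intro: less_le_trans[OF _ div_le_dividend])
    then show ?thesis
      using False by (simp add: sum_of_bool_eq)
  qed simp
  then show "rcomp (\<lambda>p (c::nat\<times>nat). fst c div snd c)"
    by (simp only:) (intro rc)
qed

lemma rcomp_mod [rc]: "rcomp a \<Longrightarrow> rcomp b \<Longrightarrow> rcomp (\<lambda>p c. a p c mod b p c)"
  unfolding minus_div_mult_eq_mod[symmetric] by (intro rc)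

text \<open>\<open>list_encode\<close> codes a nonempty list as the successor of the pair of head
  and coded tail, hence the \<open>- 1\<close> before each decoding.\<close>

definition lnth :: "nat \<Rightarrow> nat \<Rightarrow> nat" where
  "lnth z i = fst (prod_decode (rec_nat z (\<lambda>k r. snd (prod_decode (r - 1))) i - 1))"

lemma lnth_list_encode:
  assumes "i < length xs"
  shows "lnth (list_encode xs) i = xs ! i"
proof -
  have "rec_nat (list_encode xs) (\<lambda>k r. snd (prod_decode (r - 1))) i = list_encode (drop i xs)"
    if "i \<le> length xs" for i
    using that
  proof (induction i)
    case (Suc i)
    then have "drop i xs = xs ! i # drop (Suc i) xs"
      by (simp add: Cons_nth_drop_Suc)
    then show ?case
      using Suc by simp
  qed simp
  moreover have "drop i xs = xs ! i # drop (Suc i) xs"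
    using assms by (simp add: Cons_nth_drop_Suc)
  ultimately show ?thesis
    using assms by (simp add: lnth_def)
qed

lemma rcomp_lnth [rc]: "rcomp a \<Longrightarrow> rcomp b \<Longrightarrow> rcomp (\<lambda>p c. lnth (a p c) (b p c))"
  by (rule rcomp_app2[where f = "\<lambda>p. lnth"], unfold lnth_def) (intro rc)

definition tab :: "nat \<Rightarrow> (nat \<Rightarrow> nat) \<Rightarrow> nat" where
  "tab N f = list_encode (map f [0..<N])"

lemma lnth_tab [simp]: "i < N \<Longrightarrow> lnth (tab N f) i = f i"
  by (simp add: tab_def lnth_list_encode)

text \<open>List codes grow at the front, so the recursion runs through the indices
  backwards.\<close>

lemma tab_rec: "tab N f = rec_nat 0 (\<lambda>k r. Suc (prod_encode (f (N - Suc k), r))) N"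
proof -
  have "rec_nat 0 (\<lambda>k r. Suc (prod_encode (f (N - Suc k), r))) m = list_encode (map f [N - m..<N])"
    if "m \<le> N" for m
    using that
  proof (induction m)
    case (Suc m)
    then have "[N - Suc m..<N] = (N - Suc m) # [N - m..<N]"
      by (simp add: upt_rec[of "N - Suc m"] Suc_diff_Suc)
    with Suc show ?case by simp
  qed simp
  from this[of N] show ?thesis
    by (simp add: tab_def)
qed

lemma rcomp_tab [rc]:
  assumes "rcomp (\<lambda>p (x::nat\<times>'c). f p (fst x) (snd x))" "rcomp (N :: baire \<Rightarrow> 'c::env \<Rightarrow> nat)"
  shows "rcomp (\<lambda>p c. tab (N p c) (\<lambda>i. f p i c))"
  unfolding tab_rec
  by (intro rc assms rcomp_subst[OF assms(1)] rcomp_snd[OF rcomp_snd[OF assms(2)]])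

text \<open>The default \<open>N\<close> makes the bounded search total; in \<open>emit\<close> it
  is the symbol for a round without a discovery.\<close>

definition first :: "nat \<Rightarrow> (nat \<Rightarrow> bool) \<Rightarrow> nat" where
  "first N P = (LEAST i. i = N \<or> P i)"

lemma first_le: "first N P \<le> N"
  unfolding first_def by (rule Least_le) simp

lemma first_less: "first N P < N \<Longrightarrow> P (first N P)"
  unfolding first_def using LeastI[of "\<lambda>i. i = N \<or> P i" N] by auto

lemma first_least: "i < first N P \<Longrightarrow> \<not> P i"
  unfolding first_def using not_less_Least[of i "\<lambda>i. i = N \<or> P i"] by auto

text \<open>The least witness is the number of indices up to which none has occurred; this turns the
  search into a bounded sum.\<close>

lemma first_sum: "first N P = (\<Sum>j<N. of_bool (\<forall>i<Suc j. \<not> P i))"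
proof -
  have "{..<N} \<inter> {j. \<forall>i<Suc j. \<not> P i} = {..<first N P}"
    using first_le[of N P] first_less[of N P] first_least[of _ N P]
    by (auto simp: less_Suc_eq_le) (metis le_neq_implies_less leI less_trans nat_less_le)
  then show ?thesis
    by (simp add: sum_of_bool_eq)
qed

lemma rcomp_first [rc]:
  assumes "rdec (\<lambda>p (x::nat\<times>'c). P p (fst x) (snd x))" "rcomp (N :: baire \<Rightarrow> 'c::env \<Rightarrow> nat)"
  shows "rcomp (\<lambda>p c. first (N p c) (\<lambda>i. P p i c))"
proof -
  have "rdec (\<lambda>p (x::nat\<times>nat\<times>'c). P p (fst x) (snd (snd x)))"
    using assms(1) unfolding rdec_def by (rule rcomp_subst[OF _ rcomp_fst])
  then show ?thesis
    unfolding first_sum by (intro rc assms)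
qed

section \<open>The sorting process\<close>

text \<open>
  A box is coded by the table of its \<open>n\<close> lower and \<open>n\<close> upper corner coordinates, which are numerators
  over \<open>2 ^ S\<close> for a scale \<open>S\<close> known from the context. A dyadic cell of level \<open>L\<close> meeting the cube is
  given by numerators up to \<open>2 ^ L\<close>, the digits of a number in base \<open>2 ^ Suc L\<close>.
\<close>

definition dig :: "nat \<Rightarrow> nat \<Rightarrow> nat \<Rightarrow> nat" where
  "dig L z i = z div (2 ^ Suc L) ^ i mod 2 ^ Suc L"

text \<open>A code of the dyadic rational \<open>a / 2 ^ k\<close> under
  \<open>nat_to_rat_surj\<close>: \<open>int_decode\<close> takes \<open>2 * a\<close> to the
  nonnegative integer \<open>a\<close>.\<close>

definition dcode :: "nat \<Rightarrow> nat \<Rightarrow> nat" where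
  "dcode a k = prod_encode (2 * a, 2 * 2 ^ k)"

text \<open>
  The first \<open>L\<close> entries are a prefix of a name of every point of the cell \<open>c\<close> of level \<open>L\<close>, and there
  are only finitely many possible values for each entry; this makes compactness available.
\<close>

definition cname :: "nat \<Rightarrow> nat \<Rightarrow> (nat \<Rightarrow> nat) \<Rightarrow> baire" where
  "cname n L c r = dcode (c (r mod n) div 2 ^ (L - r div n)) (r div n)"

text \<open>An answer of at least 2 stands for a nonzero output, which places the named point in the
  complement. The bound on \<open>k\<close> restricts the test to the first \<open>L\<close> entries
  of \<open>q\<close>.\<close>

definition acc :: "baire \<Rightarrow> nat \<Rightarrow> baire \<Rightarrow> bool" where
  "acc \<alpha> L q \<longleftrightarrow>
     (\<exists>m<Suc L. \<exists>k<Suc L. 2 \<le> query \<alpha> q m k \<and> (\<forall>j<k. query \<alpha> q m j = 0))"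

text \<open>A cell is represented by its least corner. The upper bound is inclusive, so that flat
  boxes and points on upper faces are covered by cells as well.\<close>

definition empt :: "nat \<Rightarrow> baire \<Rightarrow> nat \<Rightarrow> nat \<Rightarrow> bool" where
  "empt n \<alpha> L b \<longleftrightarrow>
     (\<forall>z<(2 ^ Suc L) ^ n. (\<forall>i<n. lnth b i \<le> dig L z i \<and> dig L z i \<le> lnth b (n + i)) \<longrightarrow>
        acc \<alpha> L (cname n L (dig L z)))"

definition piv :: "nat \<Rightarrow> nat \<Rightarrow> nat" where
  "piv n b = first n (\<lambda>i. \<forall>j<n. lnth b (n + j) - lnth b j \<le> lnth b (n + i) - lnth b i)"

text \<open>
  \<open>d = 0\<close> and \<open>d = 1\<close> give the lower and the upper half, \<open>d = 2\<close> their common face. The scale of the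
  result is one higher, so that the midpoint is again integral.
\<close>

definition half :: "nat \<Rightarrow> nat \<Rightarrow> nat \<Rightarrow> nat" where
  "half n b d = tab (2 * n) (\<lambda>r.
     if r < n then (if r = piv n b \<and> d \<noteq> 0 then lnth b r + lnth b (n + r) else 2 * lnth b r)
     else (if r - n = piv n b \<and> d \<noteq> 1 then lnth b (r - n) + lnth b r else 2 * lnth b r))"

text \<open>The same set written at the next scale: the scale grows with time even when the box
  stays.\<close>

definition dbl :: "nat \<Rightarrow> nat \<Rightarrow> nat" where
  "dbl n b = tab (2 * n) (\<lambda>r. 2 * lnth b r)"

definition cuts :: "nat \<Rightarrow> nat \<Rightarrow> nat \<Rightarrow> nat" where
  "cuts n b k = rec_nat b (\<lambda>_ b. half n b 2) k"

definition unit_box :: "nat \<Rightarrow> nat" where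
  "unit_box n = tab (2 * n) (\<lambda>r. of_bool (n \<le> r))"

definition fires :: "nat \<Rightarrow> baire \<Rightarrow> nat \<Rightarrow> nat \<Rightarrow> bool" where
  "fires n \<alpha> L b \<longleftrightarrow> empt n \<alpha> L (half n b 0) \<or> empt n \<alpha> L (half n b 1)"

text \<open>
  In the state \<open>s\<close> at time \<open>t\<close>, the box of level \<open>j\<close> has scale \<open>t + j\<close>.
\<close>

definition emit :: "nat \<Rightarrow> baire \<Rightarrow> nat \<Rightarrow> nat \<Rightarrow> nat" where
  "emit n \<alpha> t s = first n (\<lambda>j. fires n \<alpha> (Suc (t + j)) (lnth s j))"

text \<open>The \<open>of_bool\<close> term picks the surviving half: 1 if the lower half has been
  refuted, 0 if only the upper one has. Deeper levels are rebuilt from it by middle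
  sections.\<close>

definition next_box :: "nat \<Rightarrow> baire \<Rightarrow> nat \<Rightarrow> nat \<Rightarrow> nat \<Rightarrow> nat" where
  "next_box n \<alpha> t s j =
     (if j < emit n \<alpha> t s \<or> emit n \<alpha> t s = n then dbl n (lnth s j)
      else cuts n (half n (lnth s (emit n \<alpha> t s))
             (of_bool (empt n \<alpha> (Suc (t + emit n \<alpha> t s)) (half n (lnth s (emit n \<alpha> t s)) 0))))
           (j - emit n \<alpha> t s))"

definition state :: "nat \<Rightarrow> baire \<Rightarrow> nat \<Rightarrow> nat" where
  "state n \<alpha> t = rec_nat (tab (Suc n) (cuts n (unit_box n)))
     (\<lambda>t s. tab (Suc n) (next_box n \<alpha> t s)) t"

definition emission :: "nat \<Rightarrow> baire \<Rightarrow> baire" where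
  "emission n \<alpha> t = emit n \<alpha> t (state n \<alpha> t)"

text \<open>
  Stage \<open>s\<close> is usable for precision \<open>k\<close>: the symbols below \<open>r s\<close> have all been emitted before
  time \<open>s\<close>, and the box of level \<open>r s\<close> is small.
\<close>

definition good :: "nat \<Rightarrow> baire \<Rightarrow> baire \<Rightarrow> nat \<Rightarrow> nat \<Rightarrow> bool" where
  "good n \<alpha> r k s \<longleftrightarrow>
     (\<Sum>u<s. of_bool (emission n \<alpha> u < r s)) = (\<Sum>u<Suc s. of_bool (r u < r s) :: nat) \<and>
     (\<Sum>i<n. lnth (lnth (state n \<alpha> s) (r s)) (n + i) - lnth (lnth (state n \<alpha> s) (r s)) i) * 2 ^ k
       \<le> 2 ^ (s + r s)"

text \<open>In an interleaved name, position \<open>x\<close> belongs to coordinate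
  \<open>x mod n\<close> and precision \<open>x div n\<close>; the lower corner serves as
  approximation.\<close>

definition outp :: "nat \<Rightarrow> baire \<Rightarrow> baire \<Rightarrow> nat \<Rightarrow> nat \<Rightarrow> nat" where
  "outp n \<alpha> r x s = dcode (lnth (lnth (state n \<alpha> s) (r s)) (x mod n)) (s + r s)"

definition emission_map :: "nat \<Rightarrow> baire \<rightharpoonup> baire" where
  "emission_map n \<alpha> = Some (emission n \<alpha>)"

definition unsort_map :: "nat \<Rightarrow> baire \<rightharpoonup> baire" where
  "unsort_map n w =
    (let \<alpha> = \<lambda>x. w (2 * x); r = \<lambda>x. w (Suc (2 * x)) in
     if \<forall>x. \<exists>s. good n \<alpha> r (x div n) s
     then Some (\<lambda>x. outp n \<alpha> r x (LEAST s. good n \<alpha> r (x div n) s)) else None)"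

section \<open>Computability of the two maps of the reduction\<close>

lemma rcomp_dig [rc]: "rcomp a \<Longrightarrow> rcomp b \<Longrightarrow> rcomp d \<Longrightarrow> rcomp (\<lambda>p c. dig (a p c) (b p c) (d p c))"
  by (rule rcomp_app3[where f = "\<lambda>p. dig"], unfold dig_def) (intro rc)

lemma rcomp_dcode [rc]: "rcomp a \<Longrightarrow> rcomp b \<Longrightarrow> rcomp (\<lambda>p c. dcode (a p c) (b p c))"
  by (rule rcomp_app2[where f = "\<lambda>p. dcode"], unfold dcode_def) (intro rc)

lemma rcomp_piv [rc]: "rcomp a \<Longrightarrow> rcomp (\<lambda>p c. piv n (a p c))"
  by (rule rcomp_app1[where f = "\<lambda>p. piv n"], unfold piv_def) (intro rc)

lemma rcomp_half [rc]: "rcomp a \<Longrightarrow> rcomp b \<Longrightarrow> rcomp (\<lambda>p c. half n (a p c) (b p c))"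
  by (rule rcomp_app2[where f = "\<lambda>p. half n"], unfold half_def) (intro rc)

lemma rcomp_dbl [rc]: "rcomp a \<Longrightarrow> rcomp (\<lambda>p c. dbl n (a p c))"
  by (rule rcomp_app1[where f = "\<lambda>p. dbl n"], unfold dbl_def) (intro rc)

lemma rcomp_cuts [rc]: "rcomp a \<Longrightarrow> rcomp b \<Longrightarrow> rcomp (\<lambda>p c. cuts n (a p c) (b p c))"
  by (rule rcomp_app2[where f = "\<lambda>p. cuts n"], unfold cuts_def) (intro rc)

lemma query_tab: "query \<alpha> q m k = \<alpha> (Suc (prod_encode (m, tab k q)))"
  by (simp add: query_def tab_def)

text \<open>The process runs on a name extracted from the oracle by \<open>g\<close>: the whole
  oracle for \<open>emission_map\<close>, its even part for \<open>unsort_map\<close>.\<close>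

context
  fixes g :: "baire \<Rightarrow> baire"
  assumes g: "rcomp g"
begin

lemma rcomp_functional: "rcomp a \<Longrightarrow> rcomp (\<lambda>p c. g p (a p c))"
  using g by (rule rcomp_app1)

lemma rdec_empt: "rcomp a \<Longrightarrow> rcomp b \<Longrightarrow> rdec (\<lambda>p c. empt n (g p) (a p c) (b p c))"
  by (rule rdec_app2[where f = "\<lambda>p. empt n (g p)"], unfold empt_def acc_def query_tab cname_def) (intro rc rcomp_functional)

lemma rdec_fires: "rcomp a \<Longrightarrow> rcomp b \<Longrightarrow> rdec (\<lambda>p c. fires n (g p) (a p c) (b p c))"
  unfolding fires_def by (intro rc rdec_empt)

lemma rcomp_emit: "rcomp a \<Longrightarrow> rcomp b \<Longrightarrow> rcomp (\<lambda>p c. emit n (g p) (a p c) (b p c))"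
  by (rule rcomp_app2[where f = "\<lambda>p. emit n (g p)"], unfold emit_def) (intro rc rdec_fires)

lemma rcomp_next_box:
  "rcomp a \<Longrightarrow> rcomp b \<Longrightarrow> rcomp d \<Longrightarrow> rcomp (\<lambda>p c. next_box n (g p) (a p c) (b p c) (d p c))"
  by (rule rcomp_app3[where f = "\<lambda>p. next_box n (g p)"], unfold next_box_def) (intro rc rcomp_emit rdec_empt)

lemma rcomp_state: "rcomp a \<Longrightarrow> rcomp (\<lambda>p c. state n (g p) (a p c))"
  by (rule rcomp_app1[where f = "\<lambda>p. state n (g p)"], unfold state_def unit_box_def) (intro rc rcomp_next_box)

lemma rcomp_emission: "rcomp a \<Longrightarrow> rcomp (\<lambda>p c. emission n (g p) (a p c))"
  unfolding emission_def by (intro rcomp_emit rcomp_state)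

lemma rdec_good:
  assumes "rcomp r" "rcomp a" "rcomp b"
  shows "rdec (\<lambda>p c. good n (g p) (r p) (a p c) (b p c))"
  by (rule rdec_app2[where f = "\<lambda>p. good n (g p) (r p)", OF _ assms(2-3)])
    (unfold good_def, intro rc rcomp_emission rcomp_state rcomp_app1[OF assms(1)])

lemma rcomp_outp:
  assumes "rcomp r" "rcomp a" "rcomp b"
  shows "rcomp (\<lambda>p c. outp n (g p) (r p) (a p c) (b p c))"
  by (rule rcomp_app2[where f = "\<lambda>p. outp n (g p) (r p)", OF _ assms(2-3)])
    (unfold outp_def, intro rc rcomp_state rcomp_app1[OF assms(1)])

end

lemma computable_emission_map: "computable (emission_map n)"
proof -
  have "rcomp (\<lambda>p. emission n p)"
    by (rule rcomp_emission[where g = "\<lambda>p. p"]) (intro rcomp_oracle rc)+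
  then show ?thesis
    by (auto simp: computable_def rcomp_def emission_map_def)
qed

lemma computable_unsort_map: "computable (unsort_map n)"
proof -
  let ?\<alpha> = "\<lambda>w x. w (2 * x) :: nat" and ?r = "\<lambda>w x. w (Suc (2 * x)) :: nat"
  \<comment> \<open>\<open>Mu\<close> searches for a zero in the first argument, hence the negation
    and the stage in first position.\<close>
  have "rdec (\<lambda>w (c::nat\<times>nat). \<not> good n (?\<alpha> w) (?r w) (snd c div n) (fst c))"
    by (intro rc rdec_good rcomp_oracle)
  then obtain eg where eg: "\<And>w s x. peval eg w [s, x] = Some (of_bool (\<not> good n (?\<alpha> w) (?r w) (x div n) s))"
    unfolding rdec_def rcomp_def by (metis enc_simps append_Cons append_Nil fst_conv snd_conv)
  have "rcomp (\<lambda>w (c::nat\<times>nat). outp n (?\<alpha> w) (?r w) (fst c) (snd c))"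
    by (intro rc rcomp_outp rcomp_oracle)
  then obtain eo where eo: "\<And>w s x. peval eo w [x, s] = Some (outp n (?\<alpha> w) (?r w) x s)"
    unfolding rcomp_def by (metis enc_simps append_Cons append_Nil fst_conv snd_conv)
  have "peval (Comp eo [Proj 0, Mu eg]) w [x] = Some (q x)" if "unsort_map n w = Some q" for w q x
    using that by (auto simp: unsort_map_def Let_def eg eo split: if_splits)
  then show ?thesis
    unfolding computable_def by blast
qed

section \<open>Names of points and of closed sets\<close>

abbreviation rat_val :: "nat \<Rightarrow> real" where
  "rat_val m \<equiv> of_rat (nat_to_rat_surj m)"

lemma rat_val_dcode: "rat_val (dcode a k) = a / 2 ^ k"
proof -
  have "int_decode (2 * a) = int a" for a :: nat
    by (simp add: int_decode_def sum_decode_def)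
  then have "nat_to_rat_surj (dcode a k) = Fract (int a) (2 ^ k)"
    unfolding nat_to_rat_surj_def dcode_def by (simp only: prod_encode_inverse Let_def split) simp
  then show ?thesis
    by (simp add: of_rat_rat)
qed

definition ix :: "'n::finite \<Rightarrow> nat" where
  "ix = to_nat_on UNIV"

lemma bij_betw_ix: "bij_betw (ix :: 'n::finite \<Rightarrow> nat) UNIV {..<CARD('n)}"
  unfolding ix_def by (rule to_nat_on_finite) simp

lemma ix_less [simp]: "ix (i :: 'n::finite) < CARD('n)"
  using bij_betw_ix by (auto simp: bij_betw_def)

lemma ix_surj: "r < CARD('n) \<Longrightarrow> \<exists>i :: 'n::finite. ix i = r"
  using bij_betw_ix[where 'n = 'n] unfolding bij_betw_def by (metis imageE lessThan_iff)

lemma ix_div_mod [simp]: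
  "(CARD('n) * k + ix (i :: 'n::finite)) div CARD('n) = k"
  "(CARD('n) * k + ix (i :: 'n::finite)) mod CARD('n) = ix i"
  by simp_all

definition cube :: "(real ^ 'n::finite) set" where
  "cube = {x. \<forall>i. 0 \<le> x $ i \<and> x $ i \<le> 1}"

lemma compact_cube: "compact (cube :: (real ^ 'n::finite) set)"
proof -
  have "cube = cbox (0 :: real ^ 'n) 1"
    by (auto simp: cube_def mem_box_cart)
  then show ?thesis by (rule ssubst) (rule compact_cbox)
qed

lemma unit_cube_rep_eq_Some_iff:
  fixes x :: "real ^ 'n::finite"
  shows "unit_cube_rep p = Some x \<longleftrightarrow>
    x \<in> cube \<and> (\<forall>i k. \<bar>rat_val (p (CARD('n) * k + ix i)) - x $ i\<bar> \<le> (1 / 2) ^ k)"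
proof -
  have sub: "subspace_rep real_rep {0..1} q = Some y \<longleftrightarrow> real_name q y \<and> 0 \<le> y \<and> y \<le> 1" for q y
    by (auto simp: subspace_rep_def bind_eq_Some_conv real_rep_eq_Some_iff split: if_splits)
  have opt: "(if \<forall>i. S i \<noteq> None then Some (\<chi> i. the (S i)) else None) = Some y \<longleftrightarrow>
      (\<forall>i. S i = Some (y $ i))" for S :: "'n \<Rightarrow> real option" and y
  proof (cases "\<forall>i. S i \<noteq> None")
    case True
    then have "\<forall>i. \<exists>z. S i = Some z"
      by auto
    then obtain z where "\<And>i. S i = Some (z i)"
      by metis
    then show ?thesis
      by (simp add: vec_eq_iff)
  next
    case False
    then obtain i where "S i = None"
      by blast
    then show ?thesis
      using False by (auto intro!: exI[of _ i])
  qed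
  have "unit_cube_rep p = Some x \<longleftrightarrow>
      (\<forall>i. subspace_rep real_rep {0..1} (component p i) = Some (x $ i))"
    unfolding unit_cube_rep_def power_rep_def by (rule opt)
  then show ?thesis
    unfolding sub real_name_def component_def cube_def ix_def by blast
qed

section \<open>Acceptance of names and membership in the closed set\<close>

definition accepts :: "baire \<Rightarrow> baire \<Rightarrow> bool" where
  "accepts \<alpha> p \<longleftrightarrow> (\<exists>m k. 2 \<le> query \<alpha> p m k \<and> (\<forall>j<k. query \<alpha> p m j = 0))"

lemma query_cong:
  assumes "\<And>r. r < k \<Longrightarrow> p r = q r"
  shows "query \<alpha> p m k = query \<alpha> q m k"
proof -
  have "map p [0..<k] = map q [0..<k]"
    using assms by simp
  then show ?thesis
    by (simp only: query_def)
qed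

lemma acceptance_cong:
  assumes "\<And>r. r < k \<Longrightarrow> p r = q r" "2 \<le> query \<alpha> p m k \<and> (\<forall>j<k. query \<alpha> p m j = 0)"
  shows "2 \<le> query \<alpha> q m k \<and> (\<forall>j<k. query \<alpha> q m j = 0)"
proof -
  have "query \<alpha> q m j = query \<alpha> p m j" if "j \<le> k" for j
    using assms(1) that by (intro query_cong) auto
  then show ?thesis
    using assms(2) by auto
qed

lemma assoc_app_accepts:
  assumes "assoc_app \<alpha> p = Some q"
  shows "(\<exists>m. q m \<noteq> 0) \<longleftrightarrow> accepts \<alpha> p"
proof -
  have ex: "\<exists>k. query \<alpha> p m k \<noteq> 0" for m
    using assms by (auto simp: assoc_app_def split: if_splits)
  have q: "q m = query \<alpha> p m (LEAST k. query \<alpha> p m k \<noteq> 0) - 1" for m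
    using assms by (auto simp: assoc_app_def split: if_splits)
  have "q m \<noteq> 0 \<longleftrightarrow> (\<exists>k. 2 \<le> query \<alpha> p m k \<and> (\<forall>j<k. query \<alpha> p m j = 0))" for m
  proof
    assume "q m \<noteq> 0"
    then have "2 \<le> query \<alpha> p m (LEAST k. query \<alpha> p m k \<noteq> 0)"
      unfolding q by linarith
    moreover have "query \<alpha> p m j = 0" if "j < (LEAST k. query \<alpha> p m k \<noteq> 0)" for j
      using not_less_Least[OF that] by blast
    ultimately show "\<exists>k. 2 \<le> query \<alpha> p m k \<and> (\<forall>j<k. query \<alpha> p m j = 0)"
      by blast
  next
    assume "\<exists>k. 2 \<le> query \<alpha> p m k \<and> (\<forall>j<k. query \<alpha> p m j = 0)"
    then obtain k where k: "2 \<le> query \<alpha> p m k" "\<And>j. j < k \<Longrightarrow> query \<alpha> p m j = 0"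
      by blast
    have "(LEAST k. query \<alpha> p m k \<noteq> 0) = k"
    proof (rule Least_equality)
      show "query \<alpha> p m k \<noteq> 0"
        using k(1) by linarith
      show "k \<le> j" if "query \<alpha> p m j \<noteq> 0" for j
        using k(2) that by (meson not_le)
    qed
    then show "q m \<noteq> 0"
      using k(1) unfolding q by simp
  qed
  then show ?thesis
    unfolding accepts_def by blast
qed

text \<open>The realizer accepts either all names of a point or none, so membership can be tested
  with any convenient name.\<close>

lemma closed_rep_mem_iff:
  fixes A :: "(real ^ 'n::finite) set"
  assumes "closed_rep unit_cube_rep \<alpha> = Some A"
  shows "A \<subseteq> cube"
    and "unit_cube_rep p = Some x \<Longrightarrow> x \<in> A \<longleftrightarrow> \<not> accepts \<alpha> p"
proof -
  obtain f where f: "fun_name unit_cube_rep sierpinski_rep \<alpha> f"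
    and A: "A = ran unit_cube_rep - {x \<in> ran unit_cube_rep. f x}"
    using assms by (auto simp: closed_rep_def open_rep_def fun_rep_eq_Some_iff)
  show "A \<subseteq> cube"
    unfolding A by (auto simp: ran_def unit_cube_rep_eq_Some_iff)
  assume p: "unit_cube_rep p = Some x"
  then have "\<exists>q y. assoc_app \<alpha> p = Some q \<and> sierpinski_rep q = Some y \<and> y \<in> {f x}"
    using f unfolding fun_name_def realizes_def by simp
  then obtain q where q: "assoc_app \<alpha> p = Some q" "(\<exists>m. q m \<noteq> 0) = f x"
    unfolding sierpinski_rep_def by blast
  moreover have "x \<in> ran unit_cube_rep"
    using p by (auto simp: ran_def)
  ultimately show "x \<in> A \<longleftrightarrow> \<not> accepts \<alpha> p"
    using assoc_app_accepts[OF q(1)] by (auto simp: A)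
qed

text \<open>Rounding the corner of a cell of level \<open>L\<close> down to level \<open>k\<close>
  gives a cell of level \<open>k\<close> that still contains the point, and its edges have length
  \<open>(1 / 2) ^ k\<close>.\<close>

lemma cname_approx:
  fixes x :: "real ^ 'n::finite"
  assumes "c (ix i) \<le> x $ i * 2 ^ L" "x $ i * 2 ^ L \<le> c (ix i) + 1" "k \<le> L"
  shows "\<bar>rat_val (cname CARD('n) L c (CARD('n) * k + ix i)) - x $ i\<bar> \<le> (1 / 2) ^ k"
proof -
  \<comment> \<open>Here \<open>a\<close> is the rounded corner. By integrality, the strict bound on
    \<open>c (ix i)\<close> bounds \<open>c (ix i) + 1\<close> too, so the whole finer cell
    fits.\<close>
  define a where "a = c (ix i) div 2 ^ (L - k)"
  have "c (ix i) < 2 ^ (L - k) + a * 2 ^ (L - k)"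
    unfolding a_def by (rule dividend_less_div_times) simp
  then have "real (a * 2 ^ (L - k)) \<le> real (c (ix i))"
    "real (c (ix i) + 1) \<le> real ((a + 1) * 2 ^ (L - k))"
    unfolding of_nat_le_iff by (simp_all add: a_def)
  then have "real a * 2 ^ (L - k) \<le> c (ix i)" "real (c (ix i)) + 1 \<le> (real a + 1) * 2 ^ (L - k)"
    by (simp_all add: algebra_simps)
  moreover have "(2::real) ^ L = 2 ^ k * 2 ^ (L - k)"
    using assms(3) by (simp flip: power_add)
  then have "x $ i * 2 ^ L = (x $ i * 2 ^ k) * 2 ^ (L - k)"
    by simp
  ultimately have "real a * 2 ^ (L - k) \<le> (x $ i * 2 ^ k) * 2 ^ (L - k)"
    "(x $ i * 2 ^ k) * 2 ^ (L - k) \<le> (real a + 1) * 2 ^ (L - k)"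
    using assms(1,2) by linarith+
  then have "real a \<le> x $ i * 2 ^ k" "x $ i * 2 ^ k \<le> real a + 1"
    by (auto dest: mult_right_le_imp_le)
  then have "a / 2 ^ k \<le> x $ i" "x $ i \<le> (real a + 1) / 2 ^ k"
    by (simp_all add: divide_le_eq le_divide_eq)
  then have "\<bar>a / 2 ^ k - x $ i\<bar> \<le> 1 / 2 ^ k"
    by (simp add: add_divide_distrib)
  then show ?thesis
    by (simp add: cname_def rat_val_dcode a_def power_divide)
qed

lemma cname_cong: "n > 0 \<Longrightarrow> (\<And>i. i < n \<Longrightarrow> c i = d i) \<Longrightarrow> cname n L c = cname n L d"
  by (rule ext) (simp add: cname_def)

lemma digits_exist:
  fixes B :: nat
  assumes "\<And>i. i < n \<Longrightarrow> c i < B"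
  shows "\<exists>z < B ^ n. \<forall>i<n. z div B ^ i mod B = c i"
  using assms
proof (induction n arbitrary: c)
  case (Suc n)
  then have "\<exists>z<B ^ n. \<forall>i<n. z div B ^ i mod B = c (Suc i)"
    by (intro Suc.IH) simp
  then obtain z where z: "z < B ^ n" "\<And>i. i < n \<Longrightarrow> z div B ^ i mod B = c (Suc i)"
    by blast
  have c: "c 0 < B"
    using Suc.prems by simp
  have "Suc z * B \<le> B ^ n * B"
    using z(1) by (intro mult_le_mono1) simp
  then have "c 0 + z * B < B ^ Suc n"
    using c by (simp add: mult.commute)
  moreover have "(c 0 + z * B) div B ^ i mod B = c i" if "i < Suc n" for i
    using z(2) c that by (cases i) (auto simp: div_mult2_eq)
  ultimately show ?case
    by blast
qed simp

text \<open>Rounding down a point of the box gives a tested cell. Its acceptance reads only a prefix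
  that extends to a genuine name of the point, so the point lies outside \<open>A\<close>.\<close>

lemma empt_sound:
  fixes A :: "(real ^ 'n::finite) set"
  assumes "closed_rep unit_cube_rep \<alpha> = Some A" "empt CARD('n) \<alpha> L b"
    and box: "\<And>i. lnth b (ix i) \<le> x $ i * 2 ^ L \<and> x $ i * 2 ^ L \<le> lnth b (CARD('n) + ix i)"
  shows "x \<notin> A"
proof
  assume "x \<in> A"
  then have cube: "x \<in> cube"
    using closed_rep_mem_iff(1)[OF assms(1)] by blast
  define xc where "xc r = x $ (SOME i. ix i = r)" for r
  have inj: "inj (ix :: 'n \<Rightarrow> nat)"
    using bij_betw_ix by (auto simp: bij_betw_def)
  have "(SOME j. ix j = ix i) = i" for i :: 'n
    using inj by (intro some_equality) (auto dest: injD)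
  then have xc: "xc (ix i) = x $ i" for i
    by (simp add: xc_def)
  define c where "c L r = nat \<lfloor>xc r * 2 ^ L\<rfloor>" for L r
  have xnn: "0 \<le> xc r * 2 ^ L" "xc r * 2 ^ L \<le> 2 ^ L" for r L
    using cube by (auto simp: xc_def cube_def mult_left_le_one_le)
  then have creal: "real (c L r) = of_int \<lfloor>xc r * 2 ^ L\<rfloor>" for L r
    by (simp add: c_def)
  have c: "c L r \<le> xc r * 2 ^ L" "xc r * 2 ^ L \<le> real (c L r) + 1" "xc r * 2 ^ L < real (c L r) + 1" for L r
    unfolding creal by linarith+
  have cB: "c L r < 2 ^ Suc L" for r
  proof -
    have "real (c L r) \<le> 2 ^ L"
      using c(1) xnn(2) by (rule order_trans)
    then have "real (c L r) \<le> real (2 ^ L)"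
      by (simp only: of_nat_power of_nat_numeral)
    then have "c L r \<le> 2 ^ L"
      unfolding of_nat_le_iff .
    then show ?thesis
      by (simp add: le_less_trans)
  qed
  obtain z where z: "z < (2 ^ Suc L) ^ CARD('n)" "\<And>r. r < CARD('n) \<Longrightarrow> dig L z r = c L r"
    using digits_exist[of "CARD('n)" "c L", OF cB] unfolding dig_def by blast
  have "lnth b r \<le> dig L z r \<and> dig L z r \<le> lnth b (CARD('n) + r)" if "r < CARD('n)" for r
  proof -
    obtain i :: 'n where i: "ix i = r"
      using ix_surj[where 'n = 'n] \<open>r < CARD('n)\<close> by blast
    have "real (c L r) \<le> real (lnth b (CARD('n) + r))" "real (lnth b r) < real (c L r + 1)"
      using c[where L = L and r = r] box[of i] by (simp_all add: i flip: xc)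
    then have "c L r \<le> lnth b (CARD('n) + r)" "lnth b r < c L r + 1"
      unfolding of_nat_le_iff of_nat_less_iff .
    then show ?thesis
      using z(2)[OF that] by simp
  qed
  then have "acc \<alpha> L (cname CARD('n) L (dig L z))"
    using assms(2) z(1) unfolding empt_def by blast
  moreover have "cname CARD('n) L (dig L z) = cname CARD('n) L (c L)"
    by (rule cname_cong) (simp_all add: z(2))
  ultimately obtain m k where k: "k \<le> L"
    "2 \<le> query \<alpha> (cname CARD('n) L (c L)) m k \<and> (\<forall>j<k. query \<alpha> (cname CARD('n) L (c L)) m j = 0)"
    unfolding acc_def by (auto simp: less_Suc_eq_le)
  \<comment> \<open>A name of \<open>x\<close> that extends the tested prefix: entries of precision
    beyond \<open>L\<close> are taken from correspondingly finer cells.\<close>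
  define p where "p r = (let M = max L (r div CARD('n)) in cname CARD('n) M (c M) r)" for r
  have "unit_cube_rep p = Some x"
    unfolding unit_cube_rep_eq_Some_iff
  proof (intro conjI allI cube)
    fix i :: 'n and k
    show "\<bar>rat_val (p (CARD('n) * k + ix i)) - x $ i\<bar> \<le> (1 / 2) ^ k"
      unfolding p_def Let_def ix_div_mod
      using c(1,2)[where L = "max L k" and r = "ix i"] by (intro cname_approx) (simp_all only: xc max.cobounded2)
  qed
  moreover have "cname CARD('n) L (c L) r = p r" if "r < k" for r
  proof -
    have "r div CARD('n) \<le> L"
      using that k(1) by (meson div_le_dividend le_trans less_imp_le)
    then show ?thesis
      by (simp add: p_def max_absorb1)
  qed
  then have "accepts \<alpha> p"
    using acceptance_cong[where p = "cname CARD('n) L (c L)" and q = p, OF _ k(2)]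
    unfolding accepts_def by auto
  ultimately show False
    using closed_rep_mem_iff(2)[OF assms(1)] \<open>x \<in> A\<close> by blast
qed

text \<open>Koenig's lemma: by the pigeonhole principle, infinitely many sequences that agree on
  \<open>K\<close> entries include infinitely many that agree on the next entry too.\<close>

lemma konig:
  fixes f :: "nat \<Rightarrow> nat \<Rightarrow> nat"
  assumes "\<And>r. finite (range (\<lambda>j. f j r))"
  shows "\<exists>g. \<forall>K. infinite {j. \<forall>r<K. f j r = g r}"
proof -
  define P where "P K h \<longleftrightarrow> infinite {j. \<forall>r<K. f j r = h r}" for K and h :: "nat \<Rightarrow> nat"
  have ext: "\<exists>h'. P (Suc K) h' \<and> (\<forall>r<K. h r = h' r)" if "P K h" for K h
  proof -
    let ?I = "{j. \<forall>r<K. f j r = h r}"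
    have "finite ((\<lambda>j. f j K) ` ?I)"
      by (rule finite_subset[OF _ assms[of K]]) auto
    then obtain j where "infinite {j' \<in> ?I. f j' K = f j K}"
      using pigeonhole_infinite[of ?I "\<lambda>j. f j K"] \<open>P K h\<close> unfolding P_def by blast
    moreover have "{j' \<in> ?I. f j' K = f j K} = {j'. \<forall>r<Suc K. f j' r = (h(K := f j K)) r}"
      by (auto simp: less_Suc_eq)
    ultimately show ?thesis
      unfolding P_def by (intro exI[of _ "h(K := f j K)"]) auto
  qed
  have "P 0 (\<lambda>_. 0)"
    by (simp add: P_def)
  then have "\<exists>H. \<forall>K. P K (H K) \<and> (\<forall>r<K. H K r = H (Suc K) r)"
    using ext by (intro dependent_nat_choice) blast+
  then obtain H where H: "\<And>K. P K (H K)" "\<And>K r. r < K \<Longrightarrow> H K r = H (Suc K) r"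
    by blast
  have eq: "H K r = H (Suc r) r" if "Suc r \<le> K" for K r
    using that
  proof (induction K rule: dec_induct)
    case (step K)
    then show ?case
      using H(2)[of r K] by simp
  qed simp
  show ?thesis
  proof (intro exI[of _ "\<lambda>r. H (Suc r) r"] allI)
    fix K
    have "H (Suc r) r = H K r" if "r < K" for r
      using eq[of r K] that by simp
    then have "{j. \<forall>r<K. f j r = H (Suc r) r} = {j. \<forall>r<K. f j r = H K r}"
      by auto
    then show "infinite {j. \<forall>r<K. f j r = H (Suc r) r}"
      using H(1)[of K] by (simp add: P_def)
  qed
qed

text \<open>Each entry of the cell names takes finitely many values, so \<open>konig\<close>
  applies. The resulting sequence names \<open>x\<close> because the error bounds are closed
  conditions and survive the limit.\<close>

lemma limit_name:
  fixes X :: "nat \<Rightarrow> real ^ 'n::finite"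
  assumes lim: "X \<longlonglongrightarrow> x" and cube: "\<And>j. X j \<in> cube" and lv: "\<And>j. j \<le> lv j"
    and c: "\<And>j i. c j (ix i) \<le> X j $ i * 2 ^ lv j" "\<And>j i. X j $ i * 2 ^ lv j \<le> c j (ix i) + 1"
  shows "\<exists>p. unit_cube_rep p = Some x \<and>
    (\<forall>K. infinite {j. \<forall>r<K. cname CARD('n) (lv j) (c j) r = p r})"
proof -
  let ?f = "\<lambda>j. cname CARD('n) (lv j) (c j)"
  have "finite (range (\<lambda>j. ?f j r))" for r
  proof -
    define k where "k = r div CARD('n)"
    \<comment> \<open>For \<open>j > k\<close> the cell is at least as fine as precision
      \<open>k\<close> and the numerator is at most \<open>2 ^ k\<close>; the finitely many other
      \<open>j\<close> are listed separately.\<close>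
    have "?f j r \<in> (\<lambda>j. ?f j r) ` {..k} \<union> (\<lambda>a. dcode a k) ` {..2 ^ k}" for j
    proof (cases "j \<le> k")
      case False
      then have "k \<le> lv j"
        using lv[of j] by simp
      obtain i :: 'n where i: "ix i = r mod CARD('n)"
        using ix_surj[where 'n = 'n, of "r mod CARD('n)"] by auto
      have "X j $ i * 2 ^ lv j \<le> 2 ^ lv j"
        using cube[of j] by (auto simp: cube_def intro: mult_left_le_one_le)
      with c(1) have "real (c j (ix i)) \<le> 2 ^ lv j"
        by (rule order_trans)
      then have "real (c j (ix i)) \<le> real (2 ^ lv j)"
        by (simp only: of_nat_power of_nat_numeral)
      then have "c j (ix i) \<le> 2 ^ lv j"
        unfolding of_nat_le_iff .
      also have "\<dots> = 2 ^ k * 2 ^ (lv j - k)"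
        using \<open>k \<le> lv j\<close> by (simp flip: power_add)
      finally have "c j (ix i) div 2 ^ (lv j - k) \<le> 2 ^ k"
        by (simp add: div_le_mono[of _ "2 ^ k * 2 ^ (lv j - k)" "2 ^ (lv j - k)", simplified])
      then show ?thesis
        by (simp add: cname_def k_def i)
    qed auto
    then have "range (\<lambda>j. ?f j r) \<subseteq> (\<lambda>j. ?f j r) ` {..k} \<union> (\<lambda>a. dcode a k) ` {..2 ^ k}"
      by blast
    then show ?thesis
      by (rule finite_subset) simp
  qed
  then obtain p where p: "\<And>K. infinite {j. \<forall>r<K. ?f j r = p r}"
    using konig[of ?f] by blast
  have "x \<in> cube"
    using closed_sequentially[OF compact_imp_closed[OF compact_cube] cube lim] .
  moreover have "\<bar>rat_val (p (CARD('n) * k + ix i)) - x $ i\<bar> \<le> (1 / 2) ^ k" for i k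
  proof (rule field_le_epsilon)
    fix e :: real assume "e > 0"
    have "(\<lambda>j. X j $ i) \<longlonglongrightarrow> x $ i"
      using lim by (rule tendsto_vec_nth)
    then obtain N where N: "\<And>j. j \<ge> N \<Longrightarrow> \<bar>X j $ i - x $ i\<bar> < e"
      using \<open>e > 0\<close> unfolding LIMSEQ_def dist_real_def by blast
    obtain j where j: "max N k \<le> j" "\<forall>r<Suc (CARD('n) * k + ix i). ?f j r = p r"
      using p[of "Suc (CARD('n) * k + ix i)"] unfolding infinite_nat_iff_unbounded_le by blast
    have "\<bar>rat_val (p (CARD('n) * k + ix i)) - X j $ i\<bar> \<le> (1 / 2) ^ k"
      using cname_approx[where c = "c j" and x = "X j" and i = i and L = "lv j" and k = k, OF c] lv[of j] j
      by simp
    then show "\<bar>rat_val (p (CARD('n) * k + ix i)) - x $ i\<bar> \<le> (1 / 2) ^ k + e"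
      using N[of j] j(1) by simp
  qed
  ultimately have "unit_cube_rep p = Some x"
    by (simp add: unit_cube_rep_eq_Some_iff)
  with p show ?thesis
    by blast
qed

section \<open>Dyadic boxes\<close>

definition box_set :: "nat \<Rightarrow> nat \<Rightarrow> (real ^ 'n::finite) set" where
  "box_set S b = {x. \<forall>i. lnth b (ix i) \<le> x $ i * 2 ^ S \<and> x $ i * 2 ^ S \<le> lnth b (CARD('n) + ix i)}"

definition valid_box :: "nat \<Rightarrow> nat \<Rightarrow> nat \<Rightarrow> bool" where
  "valid_box n S b \<longleftrightarrow> (\<forall>i<n. lnth b i \<le> lnth b (n + i) \<and> lnth b (n + i) \<le> 2 ^ S)"

lemma lnth_half:
  assumes "i < n"
  shows "lnth (half n b d) i = (if i = piv n b \<and> d \<noteq> 0 then lnth b i + lnth b (n + i) else 2 * lnth b i)"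
    and "lnth (half n b d) (n + i) =
      (if i = piv n b \<and> d \<noteq> 1 then lnth b i + lnth b (n + i) else 2 * lnth b (n + i))"
  using assms by (simp_all add: half_def)

lemma lnth_dbl:
  assumes "i < n"
  shows "lnth (dbl n b) i = 2 * lnth b i" "lnth (dbl n b) (n + i) = 2 * lnth b (n + i)"
  using assms by (simp_all add: dbl_def)

lemma valid_box_half: "valid_box n S b \<Longrightarrow> valid_box n (Suc S) (half n b d)"
  unfolding valid_box_def by (auto simp: lnth_half)

lemma valid_box_dbl: "valid_box n S b \<Longrightarrow> valid_box n (Suc S) (dbl n b)"
  unfolding valid_box_def by (auto simp: lnth_dbl)

lemma box_set_subset_cube: "valid_box CARD('n) S b \<Longrightarrow> box_set S b \<subseteq> (cube :: (real ^ 'n::finite) set)"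
proof
  fix x :: "real ^ 'n"
  assume b: "valid_box CARD('n) S b" and x: "x \<in> box_set S b"
  show "x \<in> cube"
    unfolding cube_def mem_Collect_eq
  proof
    fix i :: 'n
    have "lnth b (CARD('n) + ix i) \<le> 2 ^ S"
      using b ix_less[of i] unfolding valid_box_def by blast
    then have "real (lnth b (CARD('n) + ix i)) \<le> real (2 ^ S)"
      unfolding of_nat_le_iff .
    then have "real (lnth b (CARD('n) + ix i)) \<le> 1 * 2 ^ S"
      by (simp only: of_nat_power of_nat_numeral mult_1)
    moreover have "real (lnth b (ix i)) \<le> x $ i * 2 ^ S" "x $ i * 2 ^ S \<le> lnth b (CARD('n) + ix i)"
      using x by (simp_all add: box_set_def)
    ultimately have "0 \<le> x $ i * 2 ^ S" "x $ i * 2 ^ S \<le> 1 * 2 ^ S"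
      by linarith+
    then show "0 \<le> x $ i \<and> x $ i \<le> 1"
      using mult_right_le_imp_le[of 0 "2 ^ S" "x $ i"] mult_right_le_imp_le[of "x $ i" "2 ^ S" 1]
      by (metis mult_zero_left zero_less_numeral zero_less_power)
  qed
qed

lemma closed_box_set: "closed (box_set S b)"
  unfolding box_set_def
  by (intro closed_Collect_all closed_Collect_conj closed_Collect_le continuous_intros)

lemma scale_iff:
  "real (2 * a) \<le> y * 2 ^ Suc S \<longleftrightarrow> real a \<le> y * 2 ^ S"
  "y * 2 ^ Suc S \<le> real (2 * a) \<longleftrightarrow> y * 2 ^ S \<le> real a"
  by (simp_all add: mult.left_commute[of y 2])

lemma box_set_dbl: "box_set (Suc S) (dbl CARD('n) b) = (box_set S b :: (real ^ 'n::finite) set)"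
  unfolding box_set_def by (simp only: lnth_dbl[OF ix_less] scale_iff)

lemma first_cong: "(\<And>i. i < n \<Longrightarrow> P i \<longleftrightarrow> Q i) \<Longrightarrow> first n P = first n Q"
  unfolding first_sum by (intro sum.cong refl arg_cong[where f = of_bool]) auto

lemma piv_dbl: "piv n (dbl n b) = piv n b"
proof -
  have "2 * a - 2 * b \<le> 2 * c - 2 * d \<longleftrightarrow> a - b \<le> c - d" for a b c d :: nat
    by linarith
  then show ?thesis
    unfolding piv_def by (intro first_cong) (simp add: lnth_dbl)
qed

lemma lnth_half_dbl:
  assumes "i < n"
  shows "lnth (half n (dbl n b) d) i = 2 * lnth (half n b d) i"
    and "lnth (half n (dbl n b) d) (n + i) = 2 * lnth (half n b d) (n + i)"
  using assms by (simp_all add: lnth_half lnth_dbl piv_dbl)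

text \<open>The longest edge does not depend on the scale. Hence the halves of a waiting box remain
  the same sets while they are tested at ever finer levels.\<close>

lemma box_set_half_dbl:
  "box_set (Suc S) (half CARD('n) (dbl CARD('n) b) d)
    = (box_set S (half CARD('n) b d) :: (real ^ 'n::finite) set)"
  unfolding box_set_def by (simp only: lnth_half_dbl[OF ix_less] scale_iff)

lemma piv_less:
  assumes "n > 0"
  shows "piv n b < n"
    and "j < n \<Longrightarrow> lnth b (n + j) - lnth b j \<le> lnth b (n + piv n b) - lnth b (piv n b)"
proof -
  define w where "w i = lnth b (n + i) - lnth b i" for i
  have "Max (w ` {..<n}) \<in> w ` {..<n}"
    using assms by (intro Max_in) auto
  then obtain i where i: "i < n" "w i = Max (w ` {..<n})"
    by auto
  then have "\<forall>j<n. w j \<le> w i"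
    by auto
  then have "\<not> i < piv n b"
    using first_least unfolding piv_def w_def by blast
  then show less: "piv n b < n"
    using i(1) by simp
  then show "j < n \<Longrightarrow> lnth b (n + j) - lnth b j \<le> lnth b (n + piv n b) - lnth b (piv n b)"
    using first_less unfolding piv_def by blast
qed

section \<open>Total edge length, dimension and bisection of boxes\<close>

definition width :: "nat \<Rightarrow> nat \<Rightarrow> nat" where
  "width n b = (\<Sum>i<n. lnth b (n + i) - lnth b i)"

text \<open>The number of these directions is the dimension of a valid box.\<close>

definition thick :: "nat \<Rightarrow> nat \<Rightarrow> nat set" where
  "thick n b = {i. i < n \<and> lnth b i < lnth b (n + i)}"

lemma finite_thick [simp]: "finite (thick n b)"
  by (simp add: thick_def)

lemma width_eq_0: "thick n b = {} \<Longrightarrow> width n b = 0"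
  by (auto simp: width_def thick_def)

lemma width_dbl: "width n (dbl n b) = 2 * width n b"
  by (simp add: width_def lnth_dbl sum_distrib_left diff_mult_distrib2)

text \<open>
  The longest edge has at least \<open>1 / n\<close> of the total width, so halving it shrinks the width by the
  factor \<open>1 - 1 / (2 n)\<close> (before rescaling).
\<close>

lemma width_half:
  assumes "n > 0" "valid_box n S b" "d < 2"
  shows "n * width n (half n b d) \<le> (2 * n - 1) * width n b"
proof -
  define w where "w i = lnth b (n + i) - lnth b i" for i
  let ?p = "piv n b"
  have "lnth (half n b d) (n + i) - lnth (half n b d) i = (if i = ?p then w i else 2 * w i)" if "i < n" for i
    using assms(2,3) that by (auto simp: lnth_half w_def valid_box_def less_2_cases_iff)
  then have "width n (half n b d) = (\<Sum>i<n. if i = ?p then w i else 2 * w i)"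
    unfolding width_def by (intro sum.cong) auto
  also have "\<dots> = (\<Sum>i<n. 2 * w i - (if i = ?p then w i else 0))"
    by (intro sum.cong) auto
  also have "\<dots> = 2 * width n b - w ?p"
    using piv_less(1)[OF assms(1), of b]
    by (subst sum_subtractf_nat) (auto simp: width_def w_def sum_distrib_left[symmetric] sum.delta)
  finally have 1: "width n (half n b d) = 2 * width n b - w ?p" .
  have "width n b \<le> (\<Sum>i<n. w ?p)"
    unfolding width_def w_def by (intro sum_mono piv_less(2)[OF assms(1)]) auto
  then show ?thesis
    unfolding 1 by (simp add: diff_mult_distrib diff_mult_distrib2 mult.left_commute)
qed

lemma thick_half_subset: "thick n (half n b d) \<subseteq> thick n b"
  by (auto simp: thick_def lnth_half split: if_splits)

lemma thick_dbl: "thick n (dbl n b) = thick n b"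
  by (auto simp: thick_def lnth_dbl)

text \<open>If any edge is nondegenerate, so is the longest one, and the middle section collapses
  it.\<close>

lemma card_thick_cut:
  assumes "n > 0"
  shows "card (thick n (half n b 2)) \<le> card (thick n b) - 1"
proof (cases "thick n b = {}")
  case False
  then obtain j where "j < n" "lnth b j < lnth b (n + j)"
    by (auto simp: thick_def)
  then have "piv n b \<in> thick n b"
    using piv_less[OF assms, where b = b] by (force simp: thick_def)
  moreover have "piv n b \<notin> thick n (half n b 2)"
    using piv_less(1)[OF assms] by (simp add: thick_def lnth_half)
  ultimately have "thick n (half n b 2) \<subseteq> thick n b - {piv n b}"
    using thick_half_subset by blast
  then have "card (thick n (half n b 2)) \<le> card (thick n b - {piv n b})"
    by (intro card_mono) auto
  then show ?thesis
    using \<open>piv n b \<in> thick n b\<close> by simp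
next
  case True
  then have "thick n (half n b 2) = {}"
    using thick_half_subset by blast
  then show ?thesis
    by simp
qed

text \<open>A segment between points of \<open>A\<close> in the two halves crosses the bisecting
  hyperplane; the crossing point is in \<open>A\<close> and in the box because both are
  convex.\<close>

lemma box_set_split:
  fixes b
  assumes "valid_box CARD('n) S b"
  defines "L \<equiv> box_set (Suc S) (half CARD('n) b 0) :: (real ^ 'n::finite) set"
    and "R \<equiv> box_set (Suc S) (half CARD('n) b 1) :: (real ^ 'n::finite) set"
    and "C \<equiv> box_set (Suc S) (half CARD('n) b 2) :: (real ^ 'n::finite) set"
  shows "L \<union> R = box_set S b" "C \<subseteq> box_set S b"
    and "convex A \<Longrightarrow> A \<inter> L \<noteq> {} \<Longrightarrow> A \<inter> R \<noteq> {} \<Longrightarrow> A \<inter> C \<noteq> {}"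
proof -
  let ?n = "CARD('n)"
  obtain q :: 'n where q: "ix q = piv ?n b"
    using ix_surj piv_less(1) zero_less_card_finite by metis
  have inj: "ix i = piv ?n b \<longleftrightarrow> i = q" for i :: 'n
    using bij_betw_ix[where 'n = 'n] unfolding q[symmetric] bij_betw_def by (auto dest: injD)
  define lo hi where "lo i = real (lnth b (ix i))" and "hi i = real (lnth b (?n + ix i))" for i :: 'n
  have le: "lo i \<le> hi i" for i
    using assms(1) by (simp add: lo_def hi_def valid_box_def)
  define mid where "mid = (lo q + hi q) / 2"
  define rest where "rest x \<longleftrightarrow> (\<forall>i. i \<noteq> q \<longrightarrow> lo i \<le> x $ i * 2 ^ S \<and> x $ i * 2 ^ S \<le> hi i)"
    for x :: "real ^ 'n"
  have mid: "lo q \<le> mid" "mid \<le> hi q"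
    using le[of q] by (simp_all add: mid_def)
  have B: "x \<in> box_set S b \<longleftrightarrow> rest x \<and> lo q \<le> x $ q * 2 ^ S \<and> x $ q * 2 ^ S \<le> hi q"
    for x :: "real ^ 'n"
    unfolding box_set_def mem_Collect_eq rest_def lo_def hi_def by metis
  have other: "lnth (half ?n b d) (ix i) = 2 * lnth b (ix i)"
    "lnth (half ?n b d) (?n + ix i) = 2 * lnth b (?n + ix i)" if "i \<noteq> q" for i d
    using that by (simp_all add: lnth_half inj)
  have H: "x \<in> box_set (Suc S) (half ?n b d) \<longleftrightarrow> rest x \<and>
     lnth (half ?n b d) (ix q) \<le> x $ q * 2 ^ Suc S \<and>
     x $ q * 2 ^ Suc S \<le> lnth (half ?n b d) (?n + ix q)" for x :: "real ^ 'n" and d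
  proof -
    have "x \<in> box_set (Suc S) (half ?n b d) \<longleftrightarrow>
      (\<forall>i. i \<noteq> q \<longrightarrow> real (2 * lnth b (ix i)) \<le> x $ i * 2 ^ Suc S \<and>
         x $ i * 2 ^ Suc S \<le> real (2 * lnth b (?n + ix i))) \<and>
      lnth (half ?n b d) (ix q) \<le> x $ q * 2 ^ Suc S \<and>
      x $ q * 2 ^ Suc S \<le> lnth (half ?n b d) (?n + ix q)"
      unfolding box_set_def mem_Collect_eq using other by metis
    then show ?thesis
      unfolding scale_iff rest_def lo_def hi_def .
  qed
  have L: "x \<in> L \<longleftrightarrow> rest x \<and> lo q \<le> x $ q * 2 ^ S \<and> x $ q * 2 ^ S \<le> mid"
    and R: "x \<in> R \<longleftrightarrow> rest x \<and> mid \<le> x $ q * 2 ^ S \<and> x $ q * 2 ^ S \<le> hi q"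
    and C: "x \<in> C \<longleftrightarrow> rest x \<and> x $ q * 2 ^ S = mid" for x :: "real ^ 'n"
    unfolding L_def R_def C_def H by (auto simp: lnth_half inj mid_def lo_def hi_def)
  show "C \<subseteq> box_set S b"
    using mid by (auto simp: B C)
  show "L \<union> R = box_set S b"
    using mid by (auto simp: B L R)
  assume A: "convex A" and "A \<inter> L \<noteq> {}" "A \<inter> R \<noteq> {}"
  then obtain x y where x: "x \<in> A" "x \<in> L" and y: "y \<in> A" "y \<in> R"
    by blast
  define M where "M = mid / 2 ^ S"
  have "x $ q \<le> M" "M \<le> y $ q"
    using x(2) y(2) by (simp_all add: L R M_def divide_le_eq le_divide_eq)
  \<comment> \<open>The parameter at which the segment from \<open>x\<close> to \<open>y\<close>
    meets the hyperplane; equal coordinates are treated apart to avoid a zero denominator.\<close>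
  then obtain u where u: "0 \<le> u" "u \<le> 1" "(1 - u) * x $ q + u * y $ q = M"
  proof (cases "x $ q = y $ q")
    case True
    with \<open>x $ q \<le> M\<close> \<open>M \<le> y $ q\<close> show ?thesis
      by (intro that[of 0]) auto
  next
    case False
    define u where "u = (M - x $ q) / (y $ q - x $ q)"
    have "u * (y $ q - x $ q) = M - x $ q"
      using False by (simp add: u_def)
    then have "(1 - u) * x $ q + u * y $ q = M"
      by (simp add: algebra_simps)
    moreover have "0 \<le> u" "u \<le> 1"
      using False \<open>x $ q \<le> M\<close> \<open>M \<le> y $ q\<close> by (auto simp: u_def divide_le_eq)
    ultimately show ?thesis
      using that by blast
  qed
  define z where "z = (1 - u) *\<^sub>R x + u *\<^sub>R y"
  have "z \<in> A"
    unfolding z_def using A x(1) y(1) u(1,2) by (simp add: convex_alt)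
  moreover have "z \<in> C"
    unfolding C rest_def
  proof (intro conjI allI impI)
    show "z $ q * 2 ^ S = mid"
      using u(3) by (simp add: z_def M_def)
    fix i
    assume i: "i \<noteq> q"
    have z: "z $ i * 2 ^ S = (1 - u) * (x $ i * 2 ^ S) + u * (y $ i * 2 ^ S)"
      by (simp add: z_def algebra_simps)
    have "rest x" "rest y"
      using x(2) y(2) by (simp_all add: L R)
    then have xy: "x $ i * 2 ^ S \<in> {lo i..hi i}" "y $ i * 2 ^ S \<in> {lo i..hi i}"
      using i by (simp_all add: rest_def)
    have "z $ i * 2 ^ S \<in> {lo i..hi i}"
      using convexD[OF convex_real_interval(5) xy, of "1 - u" u] u(1,2) by (simp add: z)
    then show "lo i \<le> z $ i * 2 ^ S" "z $ i * 2 ^ S \<le> hi i"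
      by simp_all
  qed
  ultimately show "A \<inter> C \<noteq> {}"
    by blast
qed

text \<open>If a limit of points of \<open>A\<close> had an accepted name, then the finite prefix
  responsible would, for the name given by \<open>limit_name\<close>, extend to an accepted name of
  a point of \<open>A\<close>.\<close>

lemma closed_of_rep:
  fixes A :: "(real ^ 'n::finite) set"
  assumes "closed_rep unit_cube_rep \<alpha> = Some A"
  shows "closed A"
  unfolding closed_sequential_limits
proof (intro allI impI)
  fix X x
  assume "(\<forall>j. X j \<in> A) \<and> X \<longlonglongrightarrow> x"
  then have X: "\<And>j. X j \<in> A" and lim: "X \<longlonglongrightarrow> x"
    by auto
  then have cube: "X j \<in> cube" for j
    using closed_rep_mem_iff(1)[OF assms] by blast
  define c where "c L j r = nat \<lfloor>X j $ (inv ix r) * 2 ^ L\<rfloor>" for L j r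
  have inv: "inv ix (ix i) = i" for i :: 'n
    using bij_betw_ix by (intro inv_f_f) (auto simp: bij_betw_def)
  have c: "c L j (ix i) \<le> X j $ i * 2 ^ L" "X j $ i * 2 ^ L \<le> real (c L j (ix i)) + 1" for L j i
  proof -
    have "real (c L j (ix i)) = of_int \<lfloor>X j $ i * 2 ^ L\<rfloor>"
      using cube[of j] by (simp add: c_def inv cube_def)
    then show "c L j (ix i) \<le> X j $ i * 2 ^ L" "X j $ i * 2 ^ L \<le> real (c L j (ix i)) + 1"
      by linarith+
  qed
  obtain p where p: "unit_cube_rep p = Some x"
    "\<And>K. infinite {j. \<forall>r<K. cname CARD('n) j (c j j) r = p r}"
    using limit_name[where lv = "\<lambda>j. j" and c = "\<lambda>j. c j j", OF lim cube order_refl c] by blast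
  have "\<not> accepts \<alpha> p"
  proof
    assume "accepts \<alpha> p"
    then obtain m k where mk: "2 \<le> query \<alpha> p m k \<and> (\<forall>j<k. query \<alpha> p m j = 0)"
      by (auto simp: accepts_def)
    obtain j where j: "k \<le> j" "\<And>r. r < k \<Longrightarrow> cname CARD('n) j (c j j) r = p r"
      using p(2)[of k] unfolding infinite_nat_iff_unbounded_le by blast
    define q where "q r = (let M = max j (r div CARD('n)) in cname CARD('n) M (c M j) r)" for r
    have "unit_cube_rep q = Some (X j)"
      unfolding unit_cube_rep_eq_Some_iff
    proof (intro conjI allI cube)
      fix i :: 'n and k
      show "\<bar>rat_val (q (CARD('n) * k + ix i)) - X j $ i\<bar> \<le> (1 / 2) ^ k"
        unfolding q_def Let_def ix_div_mod by (intro cname_approx c) simp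
    qed
    moreover have "p r = q r" if "r < k" for r
    proof -
      have "r div CARD('n) \<le> j"
        using that j(1) by (meson div_le_dividend le_trans less_imp_le)
      then show ?thesis
        using j(2)[OF that] by (simp add: q_def max_absorb1)
    qed
    then have "accepts \<alpha> q"
      using acceptance_cong[OF _ mk, of q] unfolding accepts_def by auto
    ultimately show False
      using X[of j] closed_rep_mem_iff(2)[OF assms] by blast
  qed
  then show "x \<in> A"
    using closed_rep_mem_iff(2)[OF assms p(1)] by simp
qed

text \<open>Compactness: corners of rejected cells accumulate at a point of \<open>D\<close>. Every
  prefix of a suitable name of it is shared by rejected cells of arbitrarily high level, so that
  name is not accepted.\<close>

lemma empt_complete:
  fixes A :: "(real ^ 'n::finite) set"
  assumes A: "closed_rep unit_cube_rep \<alpha> = Some A"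
    and D: "\<And>L. L0 \<le> L \<Longrightarrow> box_set L (b L) = D" "D \<subseteq> cube"
    and ne: "\<And>L. L0 \<le> L \<Longrightarrow> \<not> empt CARD('n) \<alpha> L (b L)"
  shows "A \<inter> D \<noteq> {}"
proof -
  let ?n = "CARD('n)"
  have "\<forall>L. \<exists>z. L0 \<le> L \<longrightarrow> (\<forall>i<?n. lnth (b L) i \<le> dig L z i \<and> dig L z i \<le> lnth (b L) (?n + i)) \<and>
      \<not> acc \<alpha> L (cname ?n L (dig L z))"
    using ne unfolding empt_def by blast
  then obtain z where z: "\<And>L i. L0 \<le> L \<Longrightarrow> i < ?n \<Longrightarrow>
      lnth (b L) i \<le> dig L (z L) i \<and> dig L (z L) i \<le> lnth (b L) (?n + i)"
    "\<And>L. L0 \<le> L \<Longrightarrow> \<not> acc \<alpha> L (cname ?n L (dig L (z L)))"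
    by metis
  define X :: "nat \<Rightarrow> real ^ 'n" where "X j = (\<chi> i. dig (L0 + j) (z (L0 + j)) (ix i) / 2 ^ (L0 + j))" for j
  have XD: "X j \<in> D" for j
  proof -
    have "X j \<in> box_set (L0 + j) (b (L0 + j))"
      unfolding box_set_def using z(1)[of "L0 + j"] by (simp add: X_def)
    then show ?thesis
      using D(1)[of "L0 + j"] by simp
  qed
  have "closed D"
    using D(1)[of L0] closed_box_set by auto
  then have "compact D"
    using compact_cube D(2) by (metis compact_Int_closed inf.absorb_iff2)
  then obtain x s where xs: "x \<in> D" "strict_mono s" "(X \<circ> s) \<longlonglongrightarrow> x"
    using XD unfolding compact_def by metis
  have lv: "j \<le> L0 + s j" for j
    using seq_suble[OF xs(2), of j] by simp
  obtain p where p: "unit_cube_rep p = Some x"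
    "\<And>K. infinite {j. \<forall>r<K. cname ?n (L0 + s j) (dig (L0 + s j) (z (L0 + s j))) r = p r}"
    using limit_name[OF xs(3), of "\<lambda>j. L0 + s j" "\<lambda>j. dig (L0 + s j) (z (L0 + s j))"] XD D(2) lv
    by (auto simp: X_def)
  have "\<not> accepts \<alpha> p"
  proof
    assume "accepts \<alpha> p"
    then obtain m k where mk: "2 \<le> query \<alpha> p m k \<and> (\<forall>j<k. query \<alpha> p m j = 0)"
      by (auto simp: accepts_def)
    \<comment> \<open>The output index \<open>m\<close> and the prefix length \<open>k\<close> must
      both lie within the bounds of \<open>acc\<close>.\<close>
    obtain j where j: "max m k \<le> j"
      "\<And>r. r < k \<Longrightarrow> cname ?n (L0 + s j) (dig (L0 + s j) (z (L0 + s j))) r = p r"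
      using p(2)[of k] unfolding infinite_nat_iff_unbounded_le by blast
    have "m < Suc (L0 + s j)" "k < Suc (L0 + s j)"
      using lv[of j] j(1) by simp_all
    then have "acc \<alpha> (L0 + s j) (cname ?n (L0 + s j) (dig (L0 + s j) (z (L0 + s j))))"
      unfolding acc_def
      using acceptance_cong[OF _ mk, of "cname ?n (L0 + s j) (dig (L0 + s j) (z (L0 + s j)))"] j(2) by metis
    then show False
      using z(2)[of "L0 + s j"] by simp
  qed
  then show ?thesis
    using closed_rep_mem_iff(2)[OF A p(1)] xs(1) by blast
qed

section \<open>Correctness of the sorting process\<close>

definition level_box :: "nat \<Rightarrow> baire \<Rightarrow> nat \<Rightarrow> nat \<Rightarrow> nat" where
  "level_box n \<alpha> t j = lnth (state n \<alpha> t) j"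

lemma level_box_0: "j \<le> n \<Longrightarrow> level_box n \<alpha> 0 j = cuts n (unit_box n) j"
  by (simp add: level_box_def state_def)

lemma emission_le: "emission n \<alpha> t \<le> n"
  by (simp add: emission_def emit_def first_le)

lemma emission_fires:
  "emission n \<alpha> t < n \<Longrightarrow>
    fires n \<alpha> (Suc (t + emission n \<alpha> t)) (level_box n \<alpha> t (emission n \<alpha> t))"
  unfolding emission_def emit_def level_box_def by (rule first_less)

lemma not_fires:
  "j < emission n \<alpha> t \<Longrightarrow> \<not> fires n \<alpha> (Suc (t + j)) (level_box n \<alpha> t j)"
  unfolding emission_def emit_def level_box_def by (rule first_least)

lemma level_box_keep:
  "j \<le> n \<Longrightarrow> j < emission n \<alpha> t \<or> emission n \<alpha> t = n \<Longrightarrow>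
    level_box n \<alpha> (Suc t) j = dbl n (level_box n \<alpha> t j)"
  by (simp add: level_box_def state_def next_box_def emission_def)

lemma level_box_emit:
  assumes "emission n \<alpha> t = j" "j < n"
  obtains d e where "{d, e} = {0, 1::nat}"
    "level_box n \<alpha> (Suc t) j = half n (level_box n \<alpha> t j) d"
    "empt n \<alpha> (Suc (t + j)) (half n (level_box n \<alpha> t j) e)"
proof -
  let ?d = "of_bool (empt n \<alpha> (Suc (t + j)) (half n (level_box n \<alpha> t j) 0)) :: nat"
  have "level_box n \<alpha> (Suc t) j = half n (level_box n \<alpha> t j) ?d"
    using assms by (simp add: level_box_def state_def next_box_def emission_def cuts_def)
  moreover have "empt n \<alpha> (Suc (t + j)) (half n (level_box n \<alpha> t j) (1 - ?d))"
    using emission_fires[of n \<alpha> t] assms by (auto simp: fires_def)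
  ultimately show ?thesis
    by (intro that[of ?d "1 - ?d"]) auto
qed

lemma level_box_emit_half:
  assumes "emission n \<alpha> t = j" "j < n"
  shows "\<exists>d<2. level_box n \<alpha> (Suc t) j = half n (level_box n \<alpha> t j) d"
proof (rule level_box_emit[OF assms])
  fix d e
  assume "{d, e} = {0, 1::nat}" "level_box n \<alpha> (Suc t) j = half n (level_box n \<alpha> t j) d"
  moreover from this(1) have "d < 2"
    by (auto simp: doubleton_eq_iff)
  ultimately show ?thesis
    by blast
qed

lemma level_box_cut:
  assumes "emission n \<alpha> t \<le> j" "j < n"
  shows "level_box n \<alpha> (Suc t) (Suc j) = half n (level_box n \<alpha> (Suc t) j) 2"
  using assms by (simp add: level_box_def state_def next_box_def emission_def cuts_def Suc_diff_le)

lemma level_box_0_Suc: "j < n \<Longrightarrow> level_box n \<alpha> 0 (Suc j) = half n (level_box n \<alpha> 0 j) 2"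
  by (simp add: level_box_0 cuts_def)

lemma valid_unit_box: "valid_box n 0 (unit_box n)"
  by (simp add: valid_box_def unit_box_def)

text \<open>An induction rule for invariants of boxes. The outer induction is on time, the inner one
  on the level, because a fresh box is cut from its predecessor at the same time.\<close>

lemma level_box_cases [consumes 1, case_names init cut keep emit]:
  assumes "j \<le> n"
    and init: "P 0 0 (unit_box n)"
    and cut: "\<And>t j b. j < n \<Longrightarrow> P t j b \<Longrightarrow> P t (Suc j) (half n b 2)"
    and keep: "\<And>t j b. j \<le> n \<Longrightarrow> P t j b \<Longrightarrow> P (Suc t) j (dbl n b)"
    and emit: "\<And>t j b d. j < n \<Longrightarrow> P t j b \<Longrightarrow> d < 2 \<Longrightarrow> P (Suc t) j (half n b d)"
  shows "P t j (level_box n \<alpha> t j)"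
  using assms(1)
proof (induction t arbitrary: j)
  case 0
  then show ?case
  proof (induction j)
    case 0
    then show ?case
      using init by (simp add: level_box_0 cuts_def)
  next
    case (Suc j)
    then show ?case
      using cut[of j 0] by (simp add: level_box_0_Suc)
  qed
next
  case (Suc t)
  note IH = Suc.IH
  from Suc.prems show ?case
  proof (induction j)
    case 0
    show ?case
    proof (cases "0 < emission n \<alpha> t \<or> emission n \<alpha> t = n")
      case True
      then show ?thesis
        using keep[of 0 t, OF _ IH[of 0]] by (simp add: level_box_keep)
    next
      case False
      then have em: "emission n \<alpha> t = 0" "0 < n"
        by auto
      obtain d where d: "d < 2" "level_box n \<alpha> (Suc t) 0 = half n (level_box n \<alpha> t 0) d"
        using level_box_emit_half[OF em] by blast
      have "P t 0 (level_box n \<alpha> t 0)"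
        by (rule IH) simp
      then show ?thesis
        unfolding d(2) using em(2) d(1) by (intro emit)
    qed
  next
    case (Suc j)
    consider "Suc j < emission n \<alpha> t \<or> emission n \<alpha> t = n" | "emission n \<alpha> t = Suc j" "Suc j < n"
      | "emission n \<alpha> t \<le> j" "j < n"
      using Suc.prems by linarith
    then show ?case
    proof cases
      case 1
      have "P (Suc t) (Suc j) (dbl n (level_box n \<alpha> t (Suc j)))"
        using Suc.prems by (intro keep IH)
      then show ?thesis
        using level_box_keep[OF Suc.prems 1] by simp
    next
      case 2
      obtain d where d: "d < 2" "level_box n \<alpha> (Suc t) (Suc j) = half n (level_box n \<alpha> t (Suc j)) d"
        using level_box_emit_half[OF 2] by blast
      have "P t (Suc j) (level_box n \<alpha> t (Suc j))"
        by (rule IH[OF Suc.prems])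
      then show ?thesis
        unfolding d(2) using 2(2) d(1) by (intro emit)
    next
      case 3
      have "P (Suc t) j (level_box n \<alpha> (Suc t) j)"
        using 3 by (intro Suc.IH) simp
      then show ?thesis
        unfolding level_box_cut[OF 3] using 3(2) by (intro cut)
    qed
  qed
qed

lemma valid_level_box: "j \<le> n \<Longrightarrow> valid_box n (t + j) (level_box n \<alpha> t j)"
  by (rule level_box_cases[where P = "\<lambda>t j. valid_box n (t + j)"])
    (auto intro: valid_unit_box valid_box_half valid_box_dbl)

text \<open>Each descent by a middle section costs a dimension and no other operation adds one;
  hence the box of level \<open>n\<close> is a point.\<close>

lemma card_thick_level_box: "j \<le> n \<Longrightarrow> card (thick n (level_box n \<alpha> t j)) \<le> n - j"
proof (rule level_box_cases[where P = "\<lambda>t j b. card (thick n b) \<le> n - j"])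
  have "card (thick n (unit_box n)) \<le> card {..<n}"
    by (intro card_mono) (auto simp: thick_def)
  then show "card (thick n (unit_box n)) \<le> n - 0"
    by simp
next
  fix j b
  assume "j < n" "card (thick n b) \<le> n - j"
  then show "card (thick n (half n b 2)) \<le> n - Suc j"
    using card_thick_cut[of n b] by linarith
next
  fix j b d
  assume "card (thick n b) \<le> n - j"
  then show "card (thick n (half n b d)) \<le> n - j"
    using card_mono[OF finite_thick thick_half_subset] by (meson order_trans)
qed (auto simp: thick_dbl)

lemma width_top_level: "width n (level_box n \<alpha> t n) = 0"
  using card_thick_level_box[of n n \<alpha> t] by (intro width_eq_0) simp

lemma empt_disjoint:
  fixes A :: "(real ^ 'n::finite) set"
  assumes "closed_rep unit_cube_rep \<alpha> = Some A" "empt CARD('n) \<alpha> L b"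
  shows "A \<inter> box_set L b = {}"
  using empt_sound[OF assms] by (auto simp: box_set_def)

lemma lnth_unit_box:
  assumes "i < n"
  shows "lnth (unit_box n) i = 0" "lnth (unit_box n) (n + i) = 1"
  using assms by (simp_all add: unit_box_def)

section \<open>The level boxes as sets and their intersection with \<open>A\<close>\<close>

context
  fixes \<alpha> and A :: "(real ^ 'n::finite) set"
  assumes A: "closed_rep unit_cube_rep \<alpha> = Some A"
begin

abbreviation level_set :: "nat \<Rightarrow> nat \<Rightarrow> (real ^ 'n) set" where
  "level_set t j \<equiv> box_set (t + j) (level_box CARD('n) \<alpha> t j)"

lemma level_set_keep:
  "j \<le> CARD('n) \<Longrightarrow> j < emission CARD('n) \<alpha> t \<or> emission CARD('n) \<alpha> t = CARD('n) \<Longrightarrow>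
    level_set (Suc t) j = level_set t j"
  by (simp add: level_box_keep box_set_dbl)

text \<open>The discarded half misses \<open>A\<close> by soundness of the test.\<close>

lemma level_set_emit:
  assumes "emission CARD('n) \<alpha> t = j" "j < CARD('n)"
  shows "level_set (Suc t) j \<subseteq> level_set t j" "A \<inter> level_set (Suc t) j = A \<inter> level_set t j"
proof -
  obtain d e where de: "{d, e} = {0, 1::nat}"
    "level_box CARD('n) \<alpha> (Suc t) j = half CARD('n) (level_box CARD('n) \<alpha> t j) d"
    "empt CARD('n) \<alpha> (Suc (t + j)) (half CARD('n) (level_box CARD('n) \<alpha> t j) e)"
    using level_box_emit[OF assms] by blast
  let ?H = "\<lambda>d. box_set (Suc (t + j)) (half CARD('n) (level_box CARD('n) \<alpha> t j) d) :: (real ^ 'n) set"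
  have "?H 0 \<union> ?H 1 = level_set t j"
    using box_set_split(1)[where 'n = 'n, OF valid_level_box] assms(2) by simp
  then have "?H d \<union> ?H e = level_set t j"
    using de(1) by (auto simp: doubleton_eq_iff)
  moreover have "A \<inter> ?H e = {}"
    using A de(3) by (rule empt_disjoint)
  ultimately show "level_set (Suc t) j \<subseteq> level_set t j" "A \<inter> level_set (Suc t) j = A \<inter> level_set t j"
    unfolding add_Suc de(2) by blast+
qed

lemma level_set_cut:
  assumes "emission CARD('n) \<alpha> t \<le> j" "j < CARD('n)"
  shows "level_set (Suc t) (Suc j)
    = box_set (Suc (Suc t + j)) (half CARD('n) (level_box CARD('n) \<alpha> (Suc t) j) 2)"
  using level_box_cut[OF assms] by simp

lemma level_set_decreasing:
  assumes "j \<le> emission CARD('n) \<alpha> t" "j \<le> CARD('n)"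
  shows "level_set (Suc t) j \<subseteq> level_set t j"
  using level_set_keep[OF assms(2)] level_set_emit(1) assms emission_le[of "CARD('n)" \<alpha> t]
  by (metis le_neq_implies_less order_refl)

text \<open>Level 0 is never created afresh and only loses parts that miss \<open>A\<close>.\<close>

lemma inter_level_0: "A \<inter> level_set t 0 = A"
proof (induction t)
  case 0
  have "cube \<subseteq> level_set 0 0"
    by (auto simp: cube_def box_set_def level_box_0 cuts_def lnth_unit_box)
  then show ?case
    using closed_rep_mem_iff(1)[OF A] by blast
next
  case (Suc t)
  show ?case
  proof (cases "emission CARD('n) \<alpha> t = 0")
    case True
    then show ?thesis
      using level_set_emit(2)[OF True] Suc by simp
  next
    case False
    then show ?thesis
      using level_set_keep[of 0 t] Suc by simp
  qed
qed

text \<open>Since its creation, the box of level \<open>Suc j\<close> may have become smaller than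
  the middle section of box \<open>j\<close>, but only by parts that miss \<open>A\<close>.\<close>

lemma inter_level_Suc:
  assumes "j < CARD('n)"
  shows "A \<inter> level_set t (Suc j) = A \<inter> box_set (Suc (t + j)) (half CARD('n) (level_box CARD('n) \<alpha> t j) 2)"
    and "level_set t (Suc j) \<subseteq> level_set t j"
proof (induction t)
  case 0
  case 1
  show ?case
    using assms by (simp add: level_box_0_Suc)
  case 2
  show ?case
    using box_set_split(2)[where 'n = 'n, OF valid_level_box[of j "CARD('n)" 0]] assms by (simp add: level_box_0_Suc)
next
  case (Suc t)
  let ?k = "emission CARD('n) \<alpha> t"
  have half: "box_set (Suc (Suc t + j)) (half CARD('n) (level_box CARD('n) \<alpha> (Suc t) j) 2)
      = (box_set (Suc (t + j)) (half CARD('n) (level_box CARD('n) \<alpha> t j) 2) :: (real ^ 'n) set)"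
    if "j < ?k \<or> ?k = CARD('n)"
    using that assms by (simp add: level_box_keep box_set_half_dbl)
  consider "?k \<le> j" | "?k = Suc j" "Suc j < CARD('n)" | "Suc j < ?k \<or> ?k = CARD('n)"
    using assms by linarith
  note cs = this
  case 1
  from cs show ?case
  proof cases
    case 1
    then show ?thesis
      using level_set_cut[OF _ assms] by simp
  next
    case 2
    then show ?thesis
      using level_set_emit(2)[OF 2] half Suc.IH(1) by simp
  next
    case 3
    then show ?thesis
      using level_set_keep[of "Suc j" t] half Suc.IH(1) assms by auto
  qed
  case 2
  from cs show ?case
  proof cases
    case 1
    then show ?thesis
      using level_set_cut[OF _ assms] box_set_split(2)[where 'n = 'n, OF valid_level_box[of j "CARD('n)" "Suc t"]] assms
      by simp
  next
    case 2
    then show ?thesis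
      using level_set_emit(1)[OF 2] level_set_keep[of j t] Suc.IH(2) assms by auto
  next
    case 3
    then show ?thesis
      using level_set_keep[of "Suc j" t] level_set_keep[of j t] Suc.IH(2) assms by auto
  qed
qed

lemma level_set_antimono: "i \<le> j \<Longrightarrow> j \<le> CARD('n) \<Longrightarrow> level_set t j \<subseteq> level_set t i"
proof (induction j rule: dec_induct)
  case (step j)
  then show ?case
    using inter_level_Suc(2)[of j t] by simp
qed simp

lemma level_set_antimono_time:
  assumes "s \<le> t" "\<And>u. s \<le> u \<Longrightarrow> j \<le> emission CARD('n) \<alpha> u" "j \<le> CARD('n)"
  shows "level_set t j \<subseteq> level_set s j"
  using assms(1)
proof (induction t rule: dec_induct)
  case (step t)
  then show ?case
    using level_set_decreasing[of j t] assms(2,3) by blast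
qed simp

text \<open>If level \<open>Suc j\<close> missed \<open>A\<close> while level \<open>j\<close> is
  still fixed, then by convexity a half of box \<open>j\<close> would miss \<open>A\<close>.
  Completeness would make the test find this, and a symbol at most \<open>j\<close>, hence below
  \<open>m\<close>, would be emitted after \<open>T\<close>.\<close>

lemma inter_level_nonempty:
  assumes "convex A" "A \<noteq> {}" and T: "\<And>t. T \<le> t \<Longrightarrow> m \<le> emission CARD('n) \<alpha> t"
    and "j \<le> m" "m \<le> CARD('n)"
  shows "A \<inter> level_set T j \<noteq> {}"
  using assms(4)
proof (induction j)
  case 0
  then show ?case
    using inter_level_0 assms(2) by simp
next
  case (Suc j)
  have j: "j < CARD('n)"
    using Suc.prems assms(5) by simp
  let ?H = "\<lambda>t d. box_set (Suc (t + j)) (half CARD('n) (level_box CARD('n) \<alpha> t j) d) :: (real ^ 'n) set"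
  show ?case
  proof
    assume "A \<inter> level_set T (Suc j) = {}"
    then have "A \<inter> ?H T 2 = {}"
      using inter_level_Suc(1)[OF j] by simp
    moreover have "valid_box CARD('n) (T + j) (level_box CARD('n) \<alpha> T j)"
      using j by (intro valid_level_box) simp
    ultimately have "A \<inter> ?H T 0 = {} \<or> A \<inter> ?H T 1 = {}"
      using box_set_split(3)[where 'n = 'n, OF _ assms(1)] by blast
    then obtain d :: nat where d: "d < 2" "A \<inter> ?H T d = {}"
      by (metis one_less_numeral_iff semiring_norm(76) zero_less_numeral)
    have H: "?H t d = ?H T d" if "T \<le> t" for t
      using that
    proof (induction t rule: dec_induct)
      case (step t)
      then have "j < emission CARD('n) \<alpha> t"
        using T[of t] Suc.prems by simp
      then show ?case
        using step j by (simp add: level_box_keep box_set_half_dbl)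
    qed simp
    have ne: "\<not> empt CARD('n) \<alpha> (Suc (t + j)) (half CARD('n) (level_box CARD('n) \<alpha> t j) d)" if "T \<le> t" for t
    proof -
      have "j < emission CARD('n) \<alpha> t"
        using T[OF that] Suc.prems by simp
      then show ?thesis
        using not_fires[of j "CARD('n)" \<alpha> t] d(1) by (auto simp: fires_def less_2_cases_iff)
    qed
    have "A \<inter> ?H T d \<noteq> {}"
    proof (rule empt_complete[OF A])
      \<comment> \<open>At time \<open>t\<close> the halves are tested at level
        \<open>Suc (t + j)\<close>, so level \<open>L\<close> belongs to time
        \<open>L - Suc j\<close>.\<close>
      fix L assume "Suc (T + j) \<le> L"
      then have L: "T \<le> L - Suc j" "Suc (L - Suc j + j) = L"
        by simp_all
      show "box_set L (half CARD('n) (level_box CARD('n) \<alpha> (L - Suc j) j) d) = ?H T d"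
        using H[OF L(1)] unfolding L(2) .
      show "\<not> empt CARD('n) \<alpha> L (half CARD('n) (level_box CARD('n) \<alpha> (L - Suc j) j) d)"
        using ne[OF L(1)] unfolding L(2) .
    next
      show "?H T d \<subseteq> cube"
        using j by (intro box_set_subset_cube valid_box_half valid_level_box) simp
    qed
    with d(2) show False
      by simp
  qed
qed

text \<open>From \<open>T\<close> on, the box of level \<open>m\<close> is never created afresh, and
  each of the infinitely many emissions of \<open>m\<close> shrinks it by a fixed factor. For
  \<open>m = n\<close> it has width 0 already.\<close>

lemma width_small:
  assumes "m \<le> CARD('n)" and T: "\<And>t. T \<le> t \<Longrightarrow> m \<le> emission CARD('n) \<alpha> t"
    and inf: "infinite {t. emission CARD('n) \<alpha> t = m}"
  shows "\<exists>t\<ge>T. width CARD('n) (level_box CARD('n) \<alpha> t m) * 2 ^ k \<le> 2 ^ (t + m)"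
proof (cases "m = CARD('n)")
  case True
  then show ?thesis
    using width_top_level[of "CARD('n)" \<alpha> T] by auto
next
  case False
  then have m: "m < CARD('n)"
    using assms(1) by simp
  define rw where "rw t = real (width CARD('n) (level_box CARD('n) \<alpha> t m)) / 2 ^ (t + m)" for t
  \<comment> \<open>The factor of \<open>width_half\<close> after division by the scale, which
    doubles in each round.\<close>
  define q where "q = 1 - 1 / (2 * real CARD('n))"
  have n: "real CARD('n) \<ge> 1"
    by (simp add: Suc_leI)
  have "1 / (2 * real CARD('n)) \<le> 1"
    using n by (subst divide_le_eq_1) linarith
  then have q: "0 \<le> q" "q < 1"
    by (simp_all add: q_def)
  have keep: "rw (Suc t) = rw t" if "m < emission CARD('n) \<alpha> t" for t
  proof -
    have "level_box CARD('n) \<alpha> (Suc t) m = dbl CARD('n) (level_box CARD('n) \<alpha> t m)"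
      using that m by (intro level_box_keep) simp_all
    then show ?thesis
      by (simp add: rw_def width_dbl)
  qed
  have emit: "rw (Suc t) \<le> q * rw t" if em: "emission CARD('n) \<alpha> t = m" for t
  proof -
    let ?b = "level_box CARD('n) \<alpha> t m"
    obtain d where d: "d < 2" "level_box CARD('n) \<alpha> (Suc t) m = half CARD('n) ?b d"
      using level_box_emit_half[OF em m] by blast
    then have "CARD('n) * width CARD('n) (half CARD('n) ?b d) \<le> (2 * CARD('n) - 1) * width CARD('n) ?b"
      using m by (intro width_half[where S = "t + m"] valid_level_box) simp_all
    then have "real (CARD('n) * width CARD('n) (half CARD('n) ?b d)) \<le> real ((2 * CARD('n) - 1) * width CARD('n) ?b)"
      unfolding of_nat_le_iff .
    also have "\<dots> = (2 * real CARD('n) - 1) * real (width CARD('n) ?b)"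
      by (simp add: of_nat_diff Suc_leI)
    also have "\<dots> = real CARD('n) * (2 * q * width CARD('n) ?b)"
      using n by (simp add: q_def field_simps)
    finally have "real (width CARD('n) (half CARD('n) ?b d)) \<le> 2 * q * width CARD('n) ?b"
      using n by simp
    then show ?thesis
      unfolding rw_def d(2) by (simp add: field_simps)
  qed
  have bound: "rw t \<le> q ^ card {u. T \<le> u \<and> u < t \<and> emission CARD('n) \<alpha> u = m} * rw T" if "T \<le> t" for t
    using that
  proof (induction t rule: dec_induct)
    case base
    have "{u. T \<le> u \<and> u < T \<and> emission CARD('n) \<alpha> u = m} = {}"
      by auto
    then show ?case
      by (simp only: card.empty power_0 mult_1 order_refl)
  next
    case (step t)
    let ?S = "\<lambda>t. {u. T \<le> u \<and> u < t \<and> emission CARD('n) \<alpha> u = m}"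
    show ?case
    proof (cases "emission CARD('n) \<alpha> t = m")
      case True
      have S: "?S (Suc t) = insert t (?S t)"
        using step.hyps True by (auto simp: less_Suc_eq)
      have "finite (?S t)"
        by (rule finite_subset[of _ "{..<t}"]) auto
      then have "card (?S (Suc t)) = Suc (card (?S t))"
        unfolding S by simp
      then show ?thesis
        using emit[OF True] mult_left_mono[OF step.IH q(1)] by (simp only: power_Suc mult.assoc)
    next
      case False
      then have "?S (Suc t) = ?S t"
        by (auto simp: less_Suc_eq)
      moreover have "m < emission CARD('n) \<alpha> t"
        using T[of t] step.hyps False by simp
      ultimately show ?thesis
        using keep step.IH by simp
    qed
  qed
  have "(\<lambda>N. q ^ N * rw T) \<longlonglongrightarrow> 0"
    using LIMSEQ_realpow_zero[OF q] by (rule tendsto_mult_left_zero)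
  then have "\<forall>\<^sub>F N in sequentially. q ^ N * rw T < (1 / 2) ^ k"
    by (rule order_tendstoD(2)) simp
  then obtain N where N: "q ^ N * rw T < (1 / 2) ^ k"
    by (auto simp: eventually_sequentially)
  have "infinite {u. T \<le> u \<and> emission CARD('n) \<alpha> u = m}"
  proof
    assume "finite {u. T \<le> u \<and> emission CARD('n) \<alpha> u = m}"
    then have "finite ({u. T \<le> u \<and> emission CARD('n) \<alpha> u = m} \<union> {..<T})"
      by simp
    moreover have "{t. emission CARD('n) \<alpha> t = m}
        \<subseteq> {u. T \<le> u \<and> emission CARD('n) \<alpha> u = m} \<union> {..<T}"
      by auto
    ultimately show False
      using inf finite_subset by blast
  qed
  from infinite_arbitrarily_large[OF this, of N]
  obtain F where F: "finite F" "card F = N" "F \<subseteq> {u. T \<le> u \<and> emission CARD('n) \<alpha> u = m}"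
    by blast
  \<comment> \<open>Inserting 0 keeps \<open>Max\<close> meaningful if \<open>F\<close> is
    empty.\<close>
  define t where "t = max T (Suc (Max (insert 0 F)))"
  let ?S = "{u. T \<le> u \<and> u < t \<and> emission CARD('n) \<alpha> u = m}"
  have "u < t" if "u \<in> F" for u
  proof -
    have "u \<le> Max (insert 0 F)"
      using F(1) that by (intro Max_ge) simp_all
    then show ?thesis
      by (simp add: t_def less_max_iff_disj)
  qed
  then have "F \<subseteq> ?S"
    using F(3) by blast
  moreover have "finite ?S"
    by (rule finite_subset[of _ "{..<t}"]) auto
  ultimately have card: "N \<le> card ?S"
    unfolding F(2)[symmetric] by (rule card_mono[rotated])
  have "0 \<le> rw T"
    by (simp add: rw_def)
  then have "q ^ card ?S * rw T \<le> q ^ N * rw T"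
    using power_decreasing[OF card q(1)] q(2) by (intro mult_right_mono) simp_all
  moreover have "T \<le> t"
    by (simp add: t_def)
  ultimately have "rw t \<le> (1 / 2) ^ k"
    using bound[of t] N by linarith
  then have "real (width CARD('n) (level_box CARD('n) \<alpha> t m)) * 2 ^ k \<le> 2 ^ (t + m)"
  proof -
    have "rw t * 2 ^ k \<le> (1 / 2) ^ k * 2 ^ k"
      using \<open>rw t \<le> (1 / 2) ^ k\<close> by (rule mult_right_mono) simp
    then have "rw t * 2 ^ k * 2 ^ (t + m) \<le> 1 * 2 ^ (t + m)"
      by (intro mult_right_mono) (simp_all add: power_one_over)
    moreover have "rw t * 2 ^ (t + m) = width CARD('n) (level_box CARD('n) \<alpha> t m)"
      by (simp add: rw_def)
    ultimately show ?thesis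
      by (metis mult.assoc mult.commute mult_1)
  qed
  then have "real (width CARD('n) (level_box CARD('n) \<alpha> t m) * 2 ^ k) \<le> real (2 ^ (t + m))"
    by (simp only: of_nat_mult of_nat_power of_nat_numeral)
  then show ?thesis
    using \<open>T \<le> t\<close> unfolding of_nat_le_iff by blast
qed

end

section \<open>Sorted sequences\<close>

text \<open>The last fact is what makes the sorted sequence informative: up to the limit symbol, the
  occurrences of all symbols below \<open>j\<close> fill exactly an initial segment of it.\<close>

lemma sort_seq_facts:
  fixes e :: baire
  assumes "\<And>t. e t \<le> n"
  shows "infinite {t. e t = sort_limit e}" "finite {t. e t < sort_limit e}" "sort_limit e \<le> n"
    "sort_seq e u \<le> sort_limit e"
    "j \<le> sort_limit e \<Longrightarrow> sort_seq e u < j \<longleftrightarrow> u < card {t. e t < j}"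
proof -
  let ?m = "sort_limit e"
  have "range e \<subseteq> {..n}"
    using assms by auto
  then have "finite (range e)"
    by (rule finite_subset) simp
  then obtain t0 where "infinite {t \<in> UNIV. e t = e t0}"
    using pigeonhole_infinite[of UNIV e] by auto
  then show inf: "infinite {t. e t = ?m}"
    unfolding sort_limit_def using LeastI[of "\<lambda>m. infinite {t. e t = m}" "e t0"] by simp
  then obtain t where "e t = ?m"
    using not_finite_existsD by blast
  then show "?m \<le> n"
    using assms[of t] by simp
  have fin: "finite {t. e t = l}" if "l < ?m" for l
    using not_less_Least[OF that[unfolded sort_limit_def]] by blast
  have fin_lt: "finite {t. e t < j}" and card_lt: "card {t. e t < j} = (\<Sum>l<j. card {t. e t = l})"
    if "j \<le> ?m" for j
  proof -
    have eq: "{t. e t < j} = (\<Union>l<j. {t. e t = l})"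
      by auto
    show "finite {t. e t < j}"
      unfolding eq using fin that by auto
    show "card {t. e t < j} = (\<Sum>l<j. card {t. e t = l})"
      unfolding eq using fin that by (intro card_UN_disjoint) auto
  qed
  from fin_lt show "finite {t. e t < ?m}"
    by simp
  let ?P = "\<lambda>ls. concat (map (\<lambda>l. replicate (card {t. e t = l}) l) ls)"
  have set_P: "set (?P ls) \<subseteq> set ls" for ls
    by auto
  have len: "length (?P [0..<j]) = card {t. e t < j}" if "j \<le> ?m" for j
    unfolding card_lt[OF that]
    by (simp add: length_concat comp_def interv_sum_list_conv_sum_set_nat atLeast0LessThan)
  have prefix: "sort_prefix e = ?P [0..<j] @ ?P [j..<?m]" if "j \<le> ?m" for j
    unfolding sort_prefix_def using upt_add_eq_append[of 0 j "?m - j"] that by simp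
  show "sort_seq e u \<le> ?m"
  proof (cases "u < length (sort_prefix e)")
    case True
    then have "sort_prefix e ! u \<in> set [0..<?m]"
      using set_P[of "[0..<?m]"] nth_mem unfolding sort_prefix_def by blast
    then show ?thesis
      using True by (simp add: sort_seq_def)
  qed (simp add: sort_seq_def)
  assume j: "j \<le> ?m"
  show "sort_seq e u < j \<longleftrightarrow> u < card {t. e t < j}"
  proof (cases "u < card {t. e t < j}")
    case True
    then have "sort_seq e u = ?P [0..<j] ! u"
      using len[OF j] by (simp add: sort_seq_def prefix[OF j] nth_append)
    moreover have "?P [0..<j] ! u \<in> set [0..<j]"
      using set_P[of "[0..<j]"] nth_mem[of u "?P [0..<j]"] True len[OF j] by auto
    ultimately show ?thesis
      using True by simp
  next
    case False
    have "j \<le> sort_seq e u"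
    proof (cases "u < length (sort_prefix e)")
      case True
      let ?v = "u - card {t. e t < j}"
      have v: "?v < length (?P [j..<?m])"
        using True False unfolding prefix[OF j] length_append len[OF j] by simp
      have "sort_seq e u = ?P [j..<?m] ! ?v"
        using True False unfolding sort_seq_def prefix[OF j] nth_append len[OF j] by simp
      moreover have "?P [j..<?m] ! ?v \<in> set [j..<?m]"
        using set_P[of "[j..<?m]"] nth_mem[OF v] by blast
      ultimately show ?thesis
        by simp
    qed (use j in \<open>simp add: sort_seq_def\<close>)
    then show ?thesis
      using False by simp
  qed
qed

section \<open>The reduction\<close>

context
  fixes \<alpha> and A :: "(real ^ 'n::finite) set" and e r :: baire and m :: nat
  assumes A: "closed_rep unit_cube_rep \<alpha> = Some A" "convex A" "A \<noteq> {}"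
  defines "e \<equiv> emission CARD('n) \<alpha>"
  defines "r \<equiv> sort_seq e" and "m \<equiv> sort_limit e"
begin

lemmas sort_facts = sort_seq_facts[of e "CARD('n)", OF emission_le[of "CARD('n)" \<alpha>, folded e_def],
  folded r_def m_def]

lemma emission_eventually: "\<exists>T. \<forall>t\<ge>T. m \<le> e t"
proof -
  obtain T where "\<And>t. e t < m \<Longrightarrow> t < T"
    using sort_facts(2) unfolding finite_nat_set_iff_bounded by blast
  then show ?thesis
    by (meson leI le_less_trans less_irrefl)
qed

text \<open>Cantor's intersection theorem for the traces of \<open>A\<close> on the boxes of level
  \<open>m\<close>, which decrease once no symbol below \<open>m\<close> is emitted any
  more.\<close>

lemma limit_point:
  "\<exists>x\<in>A. \<exists>T. \<forall>t\<ge>T. x \<in> box_set (t + m) (level_box CARD('n) \<alpha> t m)"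
proof -
  obtain T where T: "\<And>t. T \<le> t \<Longrightarrow> m \<le> e t"
    using emission_eventually by blast
  let ?F = "\<lambda>t. A \<inter> box_set (T + t + m) (level_box CARD('n) \<alpha> (T + t) m)"
  have "compact A"
    using compact_cube closed_of_rep[OF A(1)] closed_rep_mem_iff(1)[OF A(1)]
    by (metis compact_Int_closed inf.absorb_iff2)
  then have "compact (?F t)" for t
    by (intro compact_Int_closed closed_box_set)
  moreover have "?F t \<noteq> {}" for t
    by (rule inter_level_nonempty[OF A, where m = m])
      (use T sort_facts(3) in \<open>auto simp: e_def\<close>)
  moreover have "?F t \<subseteq> ?F s" if "s \<le> t" for s t
    using level_set_antimono_time[OF A(1), of "T + s" "T + t" m] T sort_facts(3) that
    unfolding e_def by auto
  ultimately have "\<Inter> (range ?F) \<noteq> {}"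
    by (rule compact_nest)
  then obtain x where x: "\<And>t. x \<in> ?F t"
    by blast
  have "x \<in> box_set (t + m) (level_box CARD('n) \<alpha> t m)" if "T \<le> t" for t
    using x[of "t - T"] that by simp
  then show ?thesis
    using x[of 0] by blast
qed

text \<open>Once \<open>r s\<close> is visible, all smaller symbols have been listed, so the prefix
  reveals how often they are emitted over all time.\<close>

lemma sorted_count: "card {u. u < Suc s \<and> r u < r s} = card {t. e t < r s}"
proof -
  have lt: "r u < r s \<longleftrightarrow> u < card {t. e t < r s}" for u
    by (rule sort_facts(5)[OF sort_facts(4)])
  then have "card {t. e t < r s} \<le> s"
    using lt[of s] by simp
  then have "{u. u < Suc s \<and> r u < r s} = {..<card {t. e t < r s}}"
    unfolding lt by auto
  then show ?thesis
    by simp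
qed

text \<open>The decidable comparison of two counts amounts to a statement about the whole future: no
  emission below \<open>r s\<close> is still to come.\<close>

lemma good_iff:
  "good CARD('n) \<alpha> r k s \<longleftrightarrow> (\<forall>t\<ge>s. r s \<le> e t) \<and>
     width CARD('n) (level_box CARD('n) \<alpha> s (r s)) * 2 ^ k \<le> 2 ^ (s + r s)"
proof -
  have "finite {t. e t < r s}"
    by (rule finite_subset[OF _ sort_facts(2)]) (use sort_facts(4)[of s] in auto)
  then have "card {u. u < s \<and> e u < r s} = card {t. e t < r s} \<longleftrightarrow> {u. u < s \<and> e u < r s} = {t. e t < r s}"
    using card_subset_eq[of "{t. e t < r s}" "{u. u < s \<and> e u < r s}", OF _ Collect_mono] by (intro iffI) simp_all
  also have "\<dots> \<longleftrightarrow> (\<forall>t. e t < r s \<longrightarrow> t < s)"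
    by blast
  also have "\<dots> \<longleftrightarrow> (\<forall>t\<ge>s. r s \<le> e t)"
    by (metis leD leI)
  finally have count: "card {u. u < s \<and> e u < r s} = card {u. u < Suc s \<and> r u < r s} \<longleftrightarrow> (\<forall>t\<ge>s. r s \<le> e t)"
    unfolding sorted_count .
  have sum: "(\<Sum>u<N. of_bool (P u)) = card {u. u < N \<and> P u}" for N :: nat and P
    by (simp add: sum_of_bool_eq lessThan_def Collect_conj_eq)
  show ?thesis
    unfolding good_def width_def level_box_def e_def[symmetric] sum count ..
qed

lemma good_exists: "\<exists>s. good CARD('n) \<alpha> r k s"
proof -
  obtain T where T: "\<And>t. T \<le> t \<Longrightarrow> m \<le> e t"
    using emission_eventually by blast
  \<comment> \<open>Late enough both for the emissions to stay at or above \<open>m\<close> and for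
    the sorted sequence to have reached \<open>m\<close>.\<close>
  define T' where "T' = max T (card {t. e t < m})"
  obtain s where s: "T' \<le> s" "width CARD('n) (level_box CARD('n) \<alpha> s m) * 2 ^ k \<le> 2 ^ (s + m)"
    using width_small[OF A(1), of m T' k] sort_facts(1,3) T unfolding T'_def e_def by auto
  have "r s = m"
    using sort_facts(4)[of s] sort_facts(5)[of m s] s(1) by (simp add: T'_def)
  then show ?thesis
    using s T unfolding good_iff by (intro exI[of _ s]) (auto simp: T'_def)
qed

lemma good_approx:
  fixes x :: "real ^ 'n"
  assumes x: "\<And>t. T \<le> t \<Longrightarrow> x \<in> box_set (t + m) (level_box CARD('n) \<alpha> t m)"
    and "good CARD('n) \<alpha> r k s"
  shows "\<bar>rat_val (outp CARD('n) \<alpha> r (CARD('n) * k + ix i) s) - x $ i\<bar> \<le> (1 / 2) ^ k"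
proof -
  let ?b = "level_box CARD('n) \<alpha> s (r s)" and ?S = "s + r s"
  have s: "\<And>t. s \<le> t \<Longrightarrow> r s \<le> e t" "width CARD('n) ?b * 2 ^ k \<le> 2 ^ ?S"
    using assms(2) unfolding good_iff by auto
  have m: "r s \<le> m" "m \<le> CARD('n)"
    using sort_facts(3,4) by auto
  \<comment> \<open>At this time the two boxes can be compared: level \<open>m\<close> lies inside
    level \<open>r s\<close>, which has only shrunk since stage \<open>s\<close>.\<close>
  let ?t = "max s T"
  have "x \<in> box_set (?t + m) (level_box CARD('n) \<alpha> ?t m)"
    using x by simp
  also have "\<dots> \<subseteq> box_set (?t + r s) (level_box CARD('n) \<alpha> ?t (r s))"
    using m by (intro level_set_antimono[OF A(1)])
  also have "\<dots> \<subseteq> box_set ?S ?b"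
    using s(1) m by (intro level_set_antimono_time[OF A(1)]) (auto simp: e_def)
  finally have box: "lnth ?b (ix i) \<le> x $ i * 2 ^ ?S" "x $ i * 2 ^ ?S \<le> lnth ?b (CARD('n) + ix i)"
    by (simp_all add: box_set_def)
  have "lnth ?b (CARD('n) + ix i) - lnth ?b (ix i) \<le> width CARD('n) ?b"
    unfolding width_def by (rule member_le_sum) auto
  then have "(lnth ?b (CARD('n) + ix i) - lnth ?b (ix i)) * 2 ^ k \<le> 2 ^ ?S"
    using s(2) by (meson le_trans mult_le_mono1)
  then have "real ((lnth ?b (CARD('n) + ix i) - lnth ?b (ix i)) * 2 ^ k) \<le> real (2 ^ ?S)"
    unfolding of_nat_le_iff .
  moreover have "lnth ?b (ix i) \<le> lnth ?b (CARD('n) + ix i)"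
    using box by linarith
  ultimately have "(real (lnth ?b (CARD('n) + ix i)) - lnth ?b (ix i)) * 2 ^ k \<le> 2 ^ ?S"
    by (simp add: of_nat_diff)
  then have "(x $ i * 2 ^ ?S - lnth ?b (ix i)) * 2 ^ k \<le> 2 ^ ?S"
    using box(2) by (meson diff_right_mono mult_right_mono order_trans zero_le_numeral zero_le_power)
  then have "x $ i * 2 ^ ?S - lnth ?b (ix i) \<le> 2 ^ ?S / 2 ^ k"
    by (simp add: le_divide_eq)
  then have "(x $ i * 2 ^ ?S - lnth ?b (ix i)) / 2 ^ ?S \<le> (2 ^ ?S / 2 ^ k) / 2 ^ ?S"
    by (rule divide_right_mono) simp
  moreover have "real (lnth ?b (ix i)) / 2 ^ ?S \<le> x $ i"
    using box(1) by (simp add: divide_le_eq)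
  ultimately have "\<bar>lnth ?b (ix i) / 2 ^ ?S - x $ i\<bar> \<le> (1 / 2) ^ k"
    by (simp add: diff_divide_distrib power_one_over)
  then show ?thesis
    by (simp only: outp_def rat_val_dcode ix_div_mod level_box_def)
qed

text \<open>Different positions may use different stages and levels, but all of them approximate the
  same point \<open>x\<close>, so together they form a name.\<close>

lemma unsort_correct:
  "\<exists>q x. unsort_map CARD('n) (baire_pair \<alpha> r) = Some q \<and> unit_cube_rep q = Some x \<and> x \<in> A"
proof -
  from limit_point obtain x where xA: "x \<in> A"
    and exT: "\<exists>T. \<forall>t\<ge>T. x \<in> box_set (t + m) (level_box CARD('n) \<alpha> t m)"
    by (rule bexE)
  from exT obtain T where "\<forall>t\<ge>T. x \<in> box_set (t + m) (level_box CARD('n) \<alpha> t m)"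
    by (rule exE)
  then have x: "x \<in> box_set (t + m) (level_box CARD('n) \<alpha> t m)" if "T \<le> t" for t
    using that by blast
  let ?q = "\<lambda>u. outp CARD('n) \<alpha> r u (LEAST s. good CARD('n) \<alpha> r (u div CARD('n)) s)"
  have "\<forall>u. \<exists>s. good CARD('n) \<alpha> r (u div CARD('n)) s"
    using good_exists by blast
  moreover have "(\<lambda>u. baire_pair \<alpha> r (2 * u)) = \<alpha>" "(\<lambda>u. baire_pair \<alpha> r (Suc (2 * u))) = r"
    by (simp_all add: baire_pair_def)
  ultimately have "unsort_map CARD('n) (baire_pair \<alpha> r) = Some ?q"
    by (simp only: unsort_map_def Let_def if_True simp_thms)
  moreover have "unit_cube_rep ?q = Some x"
    unfolding unit_cube_rep_eq_Some_iff
  proof (intro conjI allI)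
    show "x \<in> cube"
      using closed_rep_mem_iff(1)[OF A(1)] xA by (rule subsetD)
    fix i :: 'n and k
    have good: "good CARD('n) \<alpha> r k (LEAST s. good CARD('n) \<alpha> r k s)"
      using good_exists by (rule LeastI_ex)
    have "\<bar>rat_val (outp CARD('n) \<alpha> r (CARD('n) * k + ix i) (LEAST s. good CARD('n) \<alpha> r k s)) - x $ i\<bar>
        \<le> (1 / 2) ^ k"
      by (rule good_approx[where T = T, OF _ good], rule x)
    then show "\<bar>rat_val (?q (CARD('n) * k + ix i)) - x $ i\<bar> \<le> (1 / 2) ^ k"
      unfolding ix_div_mod .
  qed
  ultimately show ?thesis
    using xA by (intro exI conjI)
qed

end

theorem theorem18:
  shows "(XC :: ((real ^ 'n::finite) set, real ^ 'n) problem) \<le>\<^sub>W Sort (CARD('n) + 1)"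
  unfolding weihrauch_le_def
proof (intro exI conjI allI impI)
  let ?n = "CARD('n)"
  show "computable (emission_map ?n)" "computable (unsort_map ?n)"
    by (rule computable_emission_map computable_unsort_map)+
  fix G
  assume G: "G \<turnstile>\<^sub>R Sort (?n + 1)"
  show "(\<lambda>p. Option.bind (emission_map ?n p) (\<lambda>h. Option.bind (G h) (\<lambda>r. unsort_map ?n (baire_pair p r))))
    \<turnstile>\<^sub>R (XC :: ((real ^ 'n) set, real ^ 'n) problem)"
    unfolding realizes_def
  proof (intro allI impI)
    fix \<alpha> and A :: "(real ^ 'n) set"
    assume "src XC \<alpha> = Some A \<and> val XC A \<noteq> {}"
    then have A: "closed_rep unit_cube_rep \<alpha> = Some A" "convex A" "A \<noteq> {}"
      by (auto simp: XC_def restrict_problem_def closed_choice_def split: if_splits)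
    let ?e = "emission ?n \<alpha>"
    have "src (Sort (?n + 1)) ?e = Some ?e \<and> val (Sort (?n + 1)) ?e \<noteq> {}"
      using emission_le[of ?n \<alpha>] by (simp add: Sort_def seq_rep_def less_Suc_eq_le)
    then obtain q y where "G ?e = Some q" "tgt (Sort (?n + 1)) q = Some y" "y \<in> val (Sort (?n + 1)) ?e"
      using G unfolding realizes_def by blast
    \<comment> \<open>\<open>Sort\<close> is single-valued and each sequence is its own only name,
      so \<open>G\<close> must return the sorted sequence itself.\<close>
    then have "G ?e = Some (sort_seq ?e)"
      by (simp add: Sort_def seq_rep_def split: if_splits)
    then show "\<exists>q y. Option.bind (emission_map ?n \<alpha>)
          (\<lambda>h. Option.bind (G h) (\<lambda>r. unsort_map ?n (baire_pair \<alpha> r))) = Some q \<and>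
        tgt XC q = Some y \<and> y \<in> val XC A"
      using unsort_correct[OF A] A(2)
      by (simp add: emission_map_def XC_def restrict_problem_def closed_choice_def)
  qed
qed

end
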